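(* There exist constants $L>0$ and $\epsilon\in(0,1)$ and an infinite sequence $(n_s)$ of pairwise distinct positive integers with the following property: for every $s$ there exists a constructible generating set $F_{n_s}$ of the alternating group $\mathrm{Alt}(n_s)$, of size $|F_{n_s}|\leq L$, such that the Cayley graphs $\mathcal{C}(\mathrm{Alt}(n_s);F_{n_s})$ form a family of $\epsilon$-expanders, i.e. for every $s$ the graph $\mathcal{C}(\mathrm{Alt}(n_s);F_{n_s})$ is an $\epsilon$-expander (with $L$ and $\epsilon$ independent of $s$).
   Context: $\mathrm{Alt}(n)$ denotes the alternating group on $n$ points. For a finite group $G$ with generating set $F$, $\mathcal{C}(G;F)$ denotes the Cayley graph, regarded as an undirected graph: its vertex set is $G$, and $g$ is joined to $gs$ for all $g\in G$, $s\in F$. A finite graph $\Gamma$ is called an $\epsilon$-expander, for some $\epsilon\in(0,1)$, if for every nonempty set $A$ of vertices of $\Gamma$ with $|A|\leq|\Gamma|/2$ one has $|\partial(A)|>\epsilon|A|$, where $|\Gamma|$ is the number of vertices of $\Gamma$ and $\partial(A)$ is the set of vertices of $\Gamma\setminus A$ at edge distance $1$ from $A$. The word "constructible" is used informally (meaning that the generating sets can be given explicitly) and has no formal definition; the formal content of the statement is the existence of such generating sets. *)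

theory Defs
  imports
    Complex_Main
    "HOL-Algebra.Generated_Groups"
    "HOL-Algebra.Sym_Groups"
    "Graph_Theory.Pair_Digraph"
begin

text \<open>
  The arc relation is symmetric by construction, so that \<open>F\<close> itself need not be closed under
  inverses. If \<open>\<one> \<in> F\<close> the graph has loops; these do not contribute to any vertex boundary.
\<close>

definition cayley_graph :: "('a, 'b) monoid_scheme \<Rightarrow> 'a set \<Rightarrow> 'a pair_pre_digraph" where
  "cayley_graph G F =
     \<lparr> pverts = carrier G,
       parcs = {(g, h). g \<in> carrier G \<and> h \<in> carrier G \<and>
                  (\<exists>s\<in>F. h = g \<otimes>\<^bsub>G\<^esub> s \<or> g = h \<otimes>\<^bsub>G\<^esub> s)} \<rparr>"

text \<open>A vertex outside \<open>A\<close> has distance 1 from \<open>A\<close> iff it is adjacent to some element of \<open>A\<close>.\<close>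

definition vertex_boundary :: "'a pair_pre_digraph \<Rightarrow> 'a set \<Rightarrow> 'a set" where
  "vertex_boundary \<Gamma> A = {v \<in> pverts \<Gamma> - A. \<exists>a\<in>A. (a, v) \<in> parcs \<Gamma>}"

text \<open>
  The library locale \<open>pair_pseudo_graph\<close> describes the finite undirected graphs, with loops allowed.
\<close>

definition is_expander :: "real \<Rightarrow> 'a pair_pre_digraph \<Rightarrow> bool" where
  "is_expander \<epsilon> \<Gamma> \<longleftrightarrow>
     pair_pseudo_graph \<Gamma> \<and> 0 < \<epsilon> \<and> \<epsilon> < 1 \<and>
     (\<forall>A. A \<subseteq> pverts \<Gamma> \<and> A \<noteq> {} \<and> real (card A) \<le> real (card (pverts \<Gamma>)) / 2 \<longrightarrow>
        real (card (vertex_boundary \<Gamma> A)) > \<epsilon> * real (card A))"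

definition generating_set :: "('a, 'b) monoid_scheme \<Rightarrow> 'a set \<Rightarrow> bool" where
  "generating_set G F \<longleftrightarrow> F \<subseteq> carrier G \<and> generate G F = carrier G"

end

theory Submission
  imports Defs "HOL-Analysis.L2_Norm" "HOL-Library.Indicator_Function"
    "Berlekamp_Zassenhaus.Finite_Field"
begin

text \<open>
  The proof rests on three facts.

  First, a criterion for expansion that only looks at pairs of generators. Let a finite group \<open>G\<close> be
  generated by \<open>r\<close> elements of prime order \<open>p\<close>, any two of which generate a group of nilpotency class at
  most 2. In the regular representation, the projections onto the orthogonal complements of the
  invariants of two such elements are almost orthogonal: apart from common vectors, the cosine of the
  angle between their ranges is at most \<open>1 / sqrt p\<close> (\<open>almost_orthogonal_complements\<close>). The reason is
  that the \<open>p\<close> conjugates of one element by the powers of the other give projections of equal norm that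
  are pairwise orthogonal off the common invariants. Expanding the square of the Laplacian, the sum of the
  complementary projections, one obtains \<open>\<Delta>\<^sup>2 \<ge> (1 - (r - 1) / sqrt p) \<Delta>\<close> (\<open>laplacian_gap\<close>), so
  \<open>p > (r - 1)\<^sup>2\<close> gives a spectral gap that depends on \<open>r\<close> and \<open>p\<close> only, and thereby expansion
  with respect to the powers of the generators (\<open>spectral_gap\<close>, \<open>powers_expand\<close>).

  Secondly, six permutations of the vector space of dimension \<open>N\<close> over the field with \<open>p\<close> elements that
  satisfy these hypotheses whenever \<open>N\<close> is a multiple of 3 and at least 9. They are shears: each adds to
  some coordinates a function of others. Three of them are linear maps that add to every third coordinate its right neighbour; the
  others change a single coordinate, by coordinate 0, by a product of two coordinates and by a constant. With
  \<open>p = 29\<close> the criterion applies, as 29 exceeds \<open>5\<^sup>2\<close>.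

  Thirdly, these six permutations generate the alternating group. They are even because their order is
  odd. Commutators of shears are again shears, and those of the generators yield all elementary
  transvections, then products of coordinates, and finally shears of one coordinate by the indicator
  function of a point, viewed as a function of all but three coordinates
  (\<open>has_shear_point_function\<close>). Two such shears with disjoint sets of exempted coordinates have a single moved
  point in common, so their commutator is a 3-cycle (\<open>commutator_eq_cycle3\<close>). The 3-cycles obtained in this way
  connect all points, and such a group contains all 3-cycles (\<open>cycle3_mem_if_linked\<close>).

  In summary, the degrees are \<open>29 ^ N\<close> with \<open>N\<close> running over the multiples of 3 from 9 on.
\<close>

section \<open>Averages over cyclic subgroups\<close>

text \<open>
  Functions on a finite group are treated as real functions on the whole type of which only the
  values on the carrier count; hence equalities between them are stated pointwise on the carrier.
\<close>

locale finite_group_of_exponent = group G for G (structure) +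
  fixes p :: nat
  assumes fin: "finite (carrier G)" and p_pos: "0 < p"
begin

definition ip :: "('a \<Rightarrow> real) \<Rightarrow> ('a \<Rightarrow> real) \<Rightarrow> real" where
  "ip f h = (\<Sum>g\<in>carrier G. f g * h g)"

text \<open>
  When \<open>a\<close> has order dividing \<open>p\<close>, this is the orthogonal projection onto the functions that are
  invariant under right translation by \<open>a\<close>.
\<close>

definition avg :: "'a \<Rightarrow> ('a \<Rightarrow> real) \<Rightarrow> 'a \<Rightarrow> real" where
  "avg a f g = (\<Sum>k<p. f (g \<otimes> a [^] k)) / p"

definition right_invariant :: "'a \<Rightarrow> ('a \<Rightarrow> real) \<Rightarrow> bool" where
  "right_invariant x f \<longleftrightarrow> (\<forall>g\<in>carrier G. f (g \<otimes> x) = f g)"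

lemma ip_cong:
  assumes "\<And>g. g \<in> carrier G \<Longrightarrow> f g = f' g" "\<And>g. g \<in> carrier G \<Longrightarrow> h g = h' g"
  shows "ip f h = ip f' h'"
  unfolding ip_def by (rule sum.cong) (auto simp: assms)

lemma ip_commute: "ip f h = ip h f"
  unfolding ip_def by (simp add: mult.commute)

lemma ip_diff_left: "ip (\<lambda>g. f g - f' g) h = ip f h - ip f' h"
  unfolding ip_def by (simp add: left_diff_distrib sum_subtractf)

lemma ip_diff_right: "ip h (\<lambda>g. f g - f' g) = ip h f - ip h f'"
  unfolding ip_def by (simp add: right_diff_distrib sum_subtractf)

lemma ip_add_left: "ip (\<lambda>g. f g + f' g) h = ip f h + ip f' h"
  unfolding ip_def by (simp add: distrib_right sum.distrib)

lemma ip_add_right: "ip h (\<lambda>g. f g + f' g) = ip h f + ip h f'"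
  unfolding ip_def by (simp add: distrib_left sum.distrib)

lemma ip_scale_left: "ip (\<lambda>g. c * f g) h = c * ip f h"
  unfolding ip_def by (simp add: sum_distrib_left mult.assoc)

lemma ip_scale_right: "ip h (\<lambda>g. c * f g) = c * ip h f"
  unfolding ip_def by (simp add: sum_distrib_left algebra_simps)

lemma ip_divide_left: "ip (\<lambda>g. f g / c) h = ip f h / c"
  unfolding ip_def by (simp add: sum_divide_distrib)

lemma ip_divide_right: "ip h (\<lambda>g. f g / c) = ip h f / c"
  unfolding ip_def by (simp add: sum_divide_distrib)

lemma ip_sum_left: "ip (\<lambda>g. \<Sum>i\<in>I. F i g) h = (\<Sum>i\<in>I. ip (F i) h)"
  unfolding ip_def by (simp add: sum_distrib_right) (rule sum.swap)

lemma ip_sum_right: "ip h (\<lambda>g. \<Sum>i\<in>I. F i g) = (\<Sum>i\<in>I. ip h (F i))"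
  using ip_sum_left by (simp add: ip_commute)

lemmas ip_linear = ip_diff_left ip_diff_right ip_add_left ip_add_right ip_scale_left ip_scale_right
  ip_sum_left ip_sum_right ip_divide_left ip_divide_right

lemma ip_ge_0: "0 \<le> ip f f"
  unfolding ip_def by (simp add: sum_nonneg)

lemma L2_set_eq_sqrt_ip: "L2_set f (carrier G) = sqrt (ip f f)"
  unfolding L2_set_def ip_def by (simp add: power2_eq_square)

lemma ip_Cauchy_Schwarz: "(ip f h)\<^sup>2 \<le> ip f f * ip h h"
proof -
  have "\<bar>ip f h\<bar> \<le> (\<Sum>g\<in>carrier G. \<bar>f g\<bar> * \<bar>h g\<bar>)"
    unfolding ip_def abs_mult[symmetric] by (rule sum_abs)
  also have "\<dots> \<le> sqrt (ip f f * ip h h)"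
    using L2_set_mult_ineq[of f h "carrier G"] by (simp add: L2_set_eq_sqrt_ip real_sqrt_mult)
  finally have "\<bar>ip f h\<bar>\<^sup>2 \<le> (sqrt (ip f f * ip h h))\<^sup>2" by (rule power_mono) simp
  thus ?thesis by (simp add: ip_ge_0)
qed

lemma sum_translate:
  assumes "x \<in> carrier G"
  shows "(\<Sum>g\<in>carrier G. F (g \<otimes> x)) = (\<Sum>g\<in>carrier G. F g)"
proof (rule sum.reindex_bij_betw)
  show "bij_betw (\<lambda>g. g \<otimes> x) (carrier G) (carrier G)"
    by (rule bij_betwI[where g="\<lambda>g. g \<otimes> inv x"]) (use assms in \<open>auto simp: m_assoc\<close>)
qed

lemma right_invariant_pow:
  assumes "a \<in> carrier G" "right_invariant a f"
  shows "right_invariant (a [^] (k::nat)) f"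
proof (induction k)
  case (Suc k)
  show ?case unfolding right_invariant_def
  proof
    fix g assume g: "g \<in> carrier G"
    have "f (g \<otimes> a [^] Suc k) = f ((g \<otimes> a [^] k) \<otimes> a)" using assms g by (simp add: m_assoc)
    thus "f (g \<otimes> a [^] Suc k) = f g" using assms g Suc by (simp add: right_invariant_def)
  qed
qed (simp add: right_invariant_def)

lemma avg_fixed:
  assumes "a \<in> carrier G" "right_invariant a f" "g \<in> carrier G"
  shows "avg a f g = f g"
  using right_invariant_pow[OF assms(1,2)] p_pos assms(3) by (simp add: avg_def right_invariant_def)

lemma right_invariant_avg:
  assumes "a \<in> carrier G" "a [^] p = \<one>"
  shows "right_invariant a (avg a f)"
  unfolding right_invariant_def
proof
  fix g assume g: "g \<in> carrier G"
  define F where "F k = f (g \<otimes> a [^] k)" for k :: nat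
  have *: "f (g \<otimes> a \<otimes> a [^] k) = F (Suc k)" for k
    unfolding F_def using g assms(1) nat_pow_Suc2[OF assms(1)] by (simp add: m_assoc del: nat_pow_Suc)
  have "(\<Sum>k<p. F (Suc k)) + F 0 = (\<Sum>k<p. F k) + F p"
    by (metis add.commute sum.lessThan_Suc sum.lessThan_Suc_shift)
  hence "(\<Sum>k<p. F (Suc k)) = (\<Sum>k<p. F k)"
    using assms by (simp add: F_def)
  thus "avg a f (g \<otimes> a) = avg a f g" unfolding avg_def using * by (simp add: F_def)
qed

text \<open>
  Averaging may be moved across the inner product against an invariant function; self-adjointness
  and idempotence of the average both follow from this.
\<close>

lemma ip_avg_left:
  assumes a: "a \<in> carrier G" "right_invariant a h"
  shows "ip (avg a f) h = ip f h"
proof -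
  have *: "(\<Sum>g\<in>carrier G. f (g \<otimes> a [^] k) * h g) = ip f h" for k :: nat
  proof -
    have "(\<Sum>g\<in>carrier G. f (g \<otimes> a [^] k) * h g)
        = (\<Sum>g\<in>carrier G. f (g \<otimes> a [^] k) * h (g \<otimes> a [^] k))"
      using right_invariant_pow[OF a] by (intro sum.cong) (auto simp: right_invariant_def)
    also have "\<dots> = ip f h" unfolding ip_def
      by (rule sum_translate[of "a [^] k" "\<lambda>g. f g * h g"]) (use a in simp)
    finally show ?thesis .
  qed
  have "ip (avg a f) h = (\<Sum>g\<in>carrier G. \<Sum>k<p. f (g \<otimes> a [^] k) * h g) / p"
    unfolding ip_def avg_def by (simp add: sum_distrib_right sum_divide_distrib)
  also have "\<dots> = (\<Sum>k<p. ip f h) / p"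
    by (subst sum.swap) (simp add: *)
  finally show ?thesis using p_pos by simp
qed

lemma ip_avg_avg:
  assumes "a \<in> carrier G" "a [^] p = \<one>"
  shows "ip (avg a f) (avg a h) = ip f (avg a h)"
  using ip_avg_left[OF assms(1) right_invariant_avg[OF assms]] by simp

lemma avg_self_adjoint:
  assumes "a \<in> carrier G" "a [^] p = \<one>"
  shows "ip (avg a f) h = ip f (avg a h)"
  using ip_avg_avg[OF assms, of f h] ip_avg_avg[OF assms, of h f] by (simp add: ip_commute)

lemma avg_diff: "avg a (\<lambda>g. f g - h g) g = avg a f g - avg a h g"
  unfolding avg_def by (simp add: sum_subtractf diff_divide_distrib)

lemma avg_divide: "avg a (\<lambda>g. f g / c) g = avg a f g / c"
  unfolding avg_def by (simp add: sum_divide_distrib field_simps)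

lemma avg_cong:
  assumes "a \<in> carrier G" "g \<in> carrier G" "\<And>g. g \<in> carrier G \<Longrightarrow> f g = h g"
  shows "avg a f g = avg a h g"
  unfolding avg_def using assms by simp

lemma sum_avg: "a \<in> carrier G \<Longrightarrow> (\<Sum>g\<in>carrier G. avg a f g) = (\<Sum>g\<in>carrier G. f g)"
  using ip_avg_left[of a "\<lambda>_. 1" f] by (simp add: ip_def right_invariant_def)

end

section \<open>Angles in groups of class two\<close>

text \<open>
  Two elements of order dividing the prime \<open>p\<close> that generate a group of nilpotency class at most 2. Writing
  \<open>P\<close>, \<open>R\<close> for the averages over \<open>a\<close> and \<open>b\<close>, the aim is that the ranges of \<open>1 - P\<close> and
  \<open>1 - R\<close> meet at an angle whose cosine is at most \<open>1 / sqrt p\<close>, except for common vectors, which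
  only help.
\<close>

locale heisenberg_pair = finite_group_of_exponent +
  fixes a b c :: 'a
  assumes prime_p: "prime p"
    and closed [simp]: "a \<in> carrier G" "b \<in> carrier G" "c \<in> carrier G"
    and a_p: "a [^] p = \<one>" and b_p: "b [^] p = \<one>"
    and ab: "a \<otimes> b = c \<otimes> (b \<otimes> a)"
    and ca: "c \<otimes> a = a \<otimes> c" and cb: "c \<otimes> b = b \<otimes> c"
begin

lemma pow_c_a: "c [^] (k::nat) \<otimes> a = a \<otimes> c [^] k"
  using ca by (induction k) (simp_all add: m_assoc, metis closed(1,3) m_assoc nat_pow_closed)

lemma pow_c_b: "c [^] (k::nat) \<otimes> b = b \<otimes> c [^] k"
  using cb by (induction k) (simp_all add: m_assoc, metis closed(2,3) m_assoc nat_pow_closed)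

lemma pow_a_b: "a [^] (t::nat) \<otimes> b = (c [^] t \<otimes> b) \<otimes> a [^] t"
proof (induction t)
  case (Suc t)
  have "a [^] Suc t \<otimes> b = a \<otimes> (a [^] t \<otimes> b)"
    using nat_pow_Suc2[OF closed(1)] by (simp add: m_assoc del: nat_pow_Suc)
  also have "\<dots> = (a \<otimes> c [^] t) \<otimes> b \<otimes> a [^] t" using Suc by (simp add: m_assoc)
  also have "\<dots> = c [^] t \<otimes> (a \<otimes> b) \<otimes> a [^] t" by (simp add: pow_c_a[symmetric] m_assoc)
  also have "\<dots> = (c [^] t \<otimes> c) \<otimes> b \<otimes> (a \<otimes> a [^] t)" by (simp add: ab m_assoc)
  also have "\<dots> = (c [^] Suc t \<otimes> b) \<otimes> a [^] Suc t"
    using nat_pow_Suc2[OF closed(1), of t] by (simp add: m_assoc)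
  finally show ?case .
qed simp

lemma pow_a_pow_b: "a [^] (t::nat) \<otimes> b [^] (k::nat) = (c [^] t \<otimes> b) [^] k \<otimes> a [^] t"
proof (induction k)
  case (Suc k)
  have "a [^] t \<otimes> b [^] Suc k = (a [^] t \<otimes> b [^] k) \<otimes> b" by (simp add: m_assoc)
  also have "\<dots> = (c [^] t \<otimes> b) [^] k \<otimes> (a [^] t \<otimes> b)" by (simp add: Suc m_assoc)
  also have "\<dots> = (c [^] t \<otimes> b) [^] k \<otimes> (c [^] t \<otimes> b) \<otimes> a [^] t" by (simp add: pow_a_b m_assoc)
  finally show ?case by simp
qed simp

lemma c_p: "c [^] p = \<one>"
proof -
  have "b = c [^] p \<otimes> b" using pow_a_b[of p] by (simp add: a_p)
  thus ?thesis by (metis closed(2,3) l_one nat_pow_closed one_closed right_cancel)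
qed

lemma conj_p: "(c [^] (t::nat) \<otimes> b) [^] p = \<one>"
proof -
  have "(c [^] t \<otimes> b) [^] p \<otimes> a [^] t = a [^] t" using pow_a_pow_b[of t p] by (simp add: b_p)
  thus ?thesis by (metis closed m_closed l_one nat_pow_closed one_closed right_cancel)
qed

text \<open>
  Conjugating \<open>b\<close> by \<open>a [^] t\<close> gives \<open>c [^] t \<otimes> b\<close>. On an \<open>a\<close>-invariant function the average over
  this conjugate is a right translate of the average over \<open>b\<close>, so all of them have the same norm.
\<close>

lemma ip_avg_conj:
  assumes "right_invariant a w"
  shows "ip (avg (c [^] (t::nat) \<otimes> b) w) (avg (c [^] t \<otimes> b) w) = ip (avg b w) (avg b w)"
proof -
  have *: "avg (c [^] t \<otimes> b) w g = avg b w (g \<otimes> a [^] t)" if g: "g \<in> carrier G" for g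
  proof -
    have "w (g \<otimes> (c [^] t \<otimes> b) [^] k) = w (g \<otimes> a [^] t \<otimes> b [^] k)" for k :: nat
    proof -
      have "w (g \<otimes> (c [^] t \<otimes> b) [^] k) = w (g \<otimes> (c [^] t \<otimes> b) [^] k \<otimes> a [^] t)"
        using right_invariant_pow[OF closed(1) assms, of t] g by (simp add: right_invariant_def)
      thus ?thesis using g by (simp add: m_assoc pow_a_pow_b)
    qed
    thus ?thesis unfolding avg_def by simp
  qed
  have "ip (avg (c [^] t \<otimes> b) w) (avg (c [^] t \<otimes> b) w)
      = (\<Sum>g\<in>carrier G. avg b w (g \<otimes> a [^] t) * avg b w (g \<otimes> a [^] t))"
    unfolding ip_def by (rule sum.cong) (simp_all add: *)
  also have "\<dots> = ip (avg b w) (avg b w)" unfolding ip_def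
    by (rule sum_translate[of "a [^] t" "\<lambda>g. avg b w g * avg b w g"]) simp
  finally show ?thesis .
qed

lemma right_invariant_avg_commuting:
  assumes "x \<in> carrier G" "y \<in> carrier G" "x \<otimes> y = y \<otimes> x" "right_invariant x f"
  shows "right_invariant x (avg y f)"
  unfolding right_invariant_def
proof
  fix g assume g: "g \<in> carrier G"
  have "f (g \<otimes> x \<otimes> y [^] k) = f (g \<otimes> y [^] k)" for k :: nat
  proof -
    have "g \<otimes> x \<otimes> y [^] k = g \<otimes> y [^] k \<otimes> x"
      using g assms(1,2) group_commutes_pow[OF assms(3)[symmetric] assms(2,1), of k] by (simp add: m_assoc)
    thus ?thesis using assms g by (simp add: right_invariant_def)
  qed
  thus "avg y f (g \<otimes> x) = avg y f g" unfolding avg_def by simp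
qed

text \<open>
  This is where \<open>p\<close> has to be prime: the quotient \<open>c [^] (t - s)\<close> of two distinct conjugates
  generates the same cyclic group as \<open>c\<close>, so invariance under both conjugates is invariance under
  all of the group generated by \<open>b\<close> and \<open>c\<close>.
\<close>

lemma fixed_by_two_conjs:
  fixes s t :: nat
  assumes s: "right_invariant (c [^] s \<otimes> b) f" and t: "right_invariant (c [^] t \<otimes> b) f"
    and st: "s < t" "t < p"
  shows "right_invariant c f" "right_invariant b f"
proof -
  have d: "right_invariant (c [^] (t - s)) f" unfolding right_invariant_def
  proof
    fix g assume g: "g \<in> carrier G"
    define y where "y = g \<otimes> inv (c [^] s \<otimes> b)"
    have y: "y \<in> carrier G" using g by (simp add: y_def)
    have gy: "g = y \<otimes> (c [^] s \<otimes> b)" using g by (simp add: y_def m_assoc)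
    have "(c [^] s \<otimes> b) \<otimes> c [^] (t - s) = c [^] s \<otimes> c [^] (t - s) \<otimes> b"
      using pow_c_b[of "t - s"] by (simp add: m_assoc)
    also have "\<dots> = c [^] t \<otimes> b" using st by (simp add: nat_pow_mult)
    finally have "g \<otimes> c [^] (t - s) = y \<otimes> (c [^] t \<otimes> b)" using y by (simp add: gy m_assoc)
    thus "f (g \<otimes> c [^] (t - s)) = f g" using s t y by (simp add: gy right_invariant_def)
  qed
  have "coprime (t - s) p"
    using prime_p st by (metis coprime_commute diff_le_self le_less_trans nat_dvd_not_less prime_imp_coprime zero_less_diff)
  then obtain m where m: "[(t - s) * m = 1] (mod p)" using cong_solve_coprime_nat by (metis One_nat_def)
  have "(c [^] (t - s)) [^] m = c"
  proof -
    have "(t - s) * m = p * ((t - s) * m div p) + 1"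
      using m prime_gt_1_nat[OF prime_p] by (metis cong_def mod_less mult_div_mod_eq)
    then obtain q where q: "(t - s) * m = p * q + 1" by blast
    have "(c [^] (t - s)) [^] m = c [^] (p * q + 1)" by (simp add: nat_pow_pow q)
    also have "\<dots> = (c [^] p) [^] q \<otimes> c" by (simp add: nat_pow_mult[symmetric] nat_pow_pow)
    finally show ?thesis by (simp add: c_p)
  qed
  thus c: "right_invariant c f" using right_invariant_pow[OF _ d, of m] by simp
  show "right_invariant b f" unfolding right_invariant_def
  proof
    fix g assume g: "g \<in> carrier G"
    have "f (g \<otimes> b) = f (g \<otimes> b \<otimes> c [^] s)"
      using right_invariant_pow[OF _ c, of s] g by (simp add: right_invariant_def)
    also have "\<dots> = f (g \<otimes> (c [^] s \<otimes> b))" using g by (simp add: m_assoc pow_c_b)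
    finally show "f (g \<otimes> b) = f g" using s g by (simp add: right_invariant_def)
  qed
qed

text \<open>
  The averages over two distinct conjugates commute, and by \<open>fixed_by_two_conjs\<close> their product has values
  that are invariant under \<open>b\<close> and \<open>c\<close>. If \<open>w\<close> has no component there, its \<open>p\<close> averages are
  pairwise orthogonal.
\<close>

lemma avg_conj_orthogonal:
  fixes s t :: nat
  assumes Z: "\<And>g. g \<in> carrier G \<Longrightarrow> avg b (avg c w) g = 0" and "s < p" "t < p" "s \<noteq> t"
  shows "ip (avg (c [^] s \<otimes> b) w) (avg (c [^] t \<otimes> b) w) = 0"
proof -
  define x where "x s = c [^] s \<otimes> b" for s :: nat
  have [simp]: "x s \<in> carrier G" and xp: "x s [^] p = \<one>" for s by (simp_all add: x_def conj_p)
  have comm: "x s \<otimes> x t = x t \<otimes> x s" for s t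
  proof -
    have "x s \<otimes> x t = c [^] s \<otimes> c [^] t \<otimes> (b \<otimes> b)" for s t
    proof -
      have "x s \<otimes> x t = c [^] s \<otimes> (b \<otimes> c [^] t) \<otimes> b" by (simp add: x_def m_assoc)
      thus ?thesis by (simp add: pow_c_b[symmetric]) (simp add: m_assoc)
    qed
    thus ?thesis by (simp add: nat_pow_mult add.commute)
  qed
  define f where "f = avg (x s) (avg (x t) w)"
  have fs: "right_invariant (x s) f" unfolding f_def by (rule right_invariant_avg) (simp_all add: xp)
  have ft: "right_invariant (x t) f" unfolding f_def
    by (rule right_invariant_avg_commuting) (simp_all add: comm right_invariant_avg xp)
  have "right_invariant c f \<and> right_invariant b f"
    using fixed_by_two_conjs[of s f t] fixed_by_two_conjs[of t f s] fs ft assms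
    by (cases "s < t") (auto simp: x_def)
  hence "ip w f = ip (avg b (avg c w)) f" by (simp add: ip_avg_left)
  also have "\<dots> = 0" unfolding ip_def by (simp add: Z)
  finally have "ip w f = 0" .
  thus ?thesis using avg_self_adjoint[OF _ xp, of s w "avg (x t) w"] by (simp add: f_def x_def)
qed

text \<open>
  Bessel's inequality for the \<open>p\<close> pairwise orthogonal projections of \<open>w\<close>, all of the same norm.
\<close>

lemma avg_b_contracts:
  assumes a: "right_invariant a w" and Z: "\<And>g. g \<in> carrier G \<Longrightarrow> avg b (avg c w) g = 0"
  shows "p * ip (avg b w) (avg b w) \<le> ip w w"
proof -
  define y where "y t = avg (c [^] (t::nat) \<otimes> b) w" for t
  define N where "N = ip (avg b w) (avg b w)"
  have y1: "ip (y t) (y t) = N" for t unfolding y_def N_def by (rule ip_avg_conj[OF a])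
  have y2: "ip (y t) w = N" for t
    using ip_avg_avg[OF _ conj_p, of t w w] y1[of t] unfolding y_def by (simp add: ip_commute)
  have "ip (\<lambda>g. \<Sum>t<p. y t g) (\<lambda>g. \<Sum>t<p. y t g) = (\<Sum>s<p. \<Sum>t<p. ip (y s) (y t))"
    by (simp add: ip_linear)
  also have "\<dots> = (\<Sum>s<p. \<Sum>t<p. if s = t then N else 0)"
    by (intro sum.cong refl) (use avg_conj_orthogonal[OF Z] y1 in \<open>auto simp: y_def\<close>)
  also have "\<dots> = p * N" by simp
  finally have 1: "ip (\<lambda>g. \<Sum>t<p. y t g) (\<lambda>g. \<Sum>t<p. y t g) = p * N" .
  have 2: "ip (\<lambda>g. \<Sum>t<p. y t g) w = p * N" by (simp add: ip_linear y2)
  have "0 \<le> ip (\<lambda>g. w g - (\<Sum>t<p. y t g)) (\<lambda>g. w g - (\<Sum>t<p. y t g))" by (rule ip_ge_0)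
  also have "\<dots> = ip w w - p * N"
    using 1 2 by (simp add: ip_diff_left ip_diff_right ip_commute)
  finally show ?thesis by (simp add: N_def)
qed

text \<open>
  Subtracting from \<open>v\<close> the component invariant under \<open>a\<close>, \<open>b\<close> and \<open>c\<close> changes neither side, so
  \<open>avg_b_contracts\<close> bounds the inner product of the two projections of the rest by \<open>e = 1 / sqrt p\<close>
  times the product of their norms. Passing from the projections to their complements is a
  computation with the Gram matrix of the rest and its two projections.
\<close>

lemma almost_orthogonal_complements:
  "- (1 / sqrt p) * (ip (\<lambda>g. v g - avg a v g) (\<lambda>g. v g - avg a v g)
        + ip (\<lambda>g. v g - avg b v g) (\<lambda>g. v g - avg b v g))
   \<le> 2 * ip (\<lambda>g. v g - avg a v g) (\<lambda>g. v g - avg b v g)"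
proof -
  define m where "m = avg b (avg c (avg a v))"
  have cm: "right_invariant c m" unfolding m_def
    by (rule right_invariant_avg_commuting) (simp_all add: cb right_invariant_avg c_p)
  have bm: "right_invariant b m" unfolding m_def by (simp add: right_invariant_avg b_p)
  have am: "right_invariant a m" unfolding right_invariant_def
  proof
    fix g assume g: "g \<in> carrier G"
    define f where "f = avg c (avg a v)"
    have fc: "right_invariant c f" unfolding f_def by (simp add: right_invariant_avg c_p)
    have fa: "right_invariant a f" unfolding f_def
      by (rule right_invariant_avg_commuting) (simp_all add: ca right_invariant_avg a_p)
    have "f (g \<otimes> a \<otimes> b [^] k) = f (g \<otimes> b [^] k)" for k :: nat
    proof -
      have "(c \<otimes> b) [^] k = b [^] k \<otimes> c [^] k"
        using pow_mult_distrib[OF cb[symmetric], of k] cb by simp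
      hence "g \<otimes> a \<otimes> b [^] k = (g \<otimes> b [^] k \<otimes> c [^] k) \<otimes> a"
        using pow_a_pow_b[of 1 k] g by (simp add: m_assoc)
      thus ?thesis using fa right_invariant_pow[OF _ fc, of k] g by (simp add: right_invariant_def)
    qed
    thus "m (g \<otimes> a) = m g" unfolding m_def f_def[symmetric] avg_def[of b] by simp
  qed
  define u where "u = (\<lambda>g. v g - m g)"
  define x where "x = avg a u"
  define y where "y = avg b u"
  have ax: "avg a v g = x g + m g" if "g \<in> carrier G" for g
    using that avg_fixed[OF _ am] by (simp add: x_def u_def avg_diff)
  have ay: "avg b v g = y g + m g" if "g \<in> carrier G" for g
    using that avg_fixed[OF _ bm] by (simp add: y_def u_def avg_diff)
  have "avg b (avg c x) g = 0" if g: "g \<in> carrier G" for g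
  proof -
    have "avg c x g' = avg c (avg a v) g' - m g'" if "g' \<in> carrier G" for g'
      using avg_cong[OF _ that, of c x "\<lambda>g. avg a v g - m g"] that avg_fixed[OF _ cm that]
      by (simp add: avg_diff ax)
    hence "avg b (avg c x) g = avg b (\<lambda>g. avg c (avg a v) g - m g) g"
      using avg_cong[OF _ g, of b "avg c x" "\<lambda>g. avg c (avg a v) g - m g"] by simp
    also have "\<dots> = 0" using avg_fixed[OF _ bm g] by (simp add: avg_diff m_def[symmetric])
    finally show ?thesis .
  qed
  hence contr: "p * ip (avg b x) (avg b x) \<le> ip x x"
    by (intro avg_b_contracts) (simp_all add: x_def right_invariant_avg a_p)
  define e where "e = 1 / sqrt p"
  have p1: "real p > 1" using prime_gt_1_nat[OF prime_p] by simp
  have e: "0 < e" "e < 1" using p1 by (simp_all add: e_def)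
  have ee: "e * e * p = 1" using p1 by (simp add: e_def field_simps)
  define A B K n where "A = ip x x" and "B = ip y y" and "K = ip x y" and "n = ip u u"
  have A0: "0 \<le> A" and B0: "0 \<le> B" by (simp_all add: A_def B_def ip_ge_0)
  have "K = ip (avg b x) y" unfolding K_def y_def by (simp add: ip_avg_left right_invariant_avg b_p)
  hence "K\<^sup>2 \<le> ip (avg b x) (avg b x) * B" unfolding B_def by (simp add: ip_Cauchy_Schwarz)
  also have "\<dots> \<le> (e * e * A) * B"
  proof (rule mult_right_mono[OF _ B0])
    have "e * e * (p * ip (avg b x) (avg b x)) \<le> e * e * A"
      using contr e by (simp add: A_def)
    thus "ip (avg b x) (avg b x) \<le> e * e * A" using ee by (metis mult.assoc mult_1)
  qed
  also have "\<dots> \<le> (e * (A + B) / 2)\<^sup>2"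
  proof -
    have "A * B \<le> ((A + B) / 2)\<^sup>2"
      using zero_le_power2[of "A - B"] by (simp add: power2_eq_square field_simps)
    hence "e\<^sup>2 * (A * B) \<le> e\<^sup>2 * ((A + B) / 2)\<^sup>2" by (rule mult_left_mono) simp
    thus ?thesis by (simp add: power2_eq_square algebra_simps)
  qed
  finally have "K \<le> e * (A + B) / 2"
    by (rule power2_le_imp_le) (use e A0 B0 in simp)
  hence K: "2 * K \<le> e * (A + B)" by simp
  have ux: "ip u x = A" "ip x u = A" unfolding A_def x_def
    using ip_avg_avg[OF closed(1) a_p, of u u] by (simp_all add: ip_commute)
  have uy: "ip u y = B" "ip y u = B" unfolding B_def y_def
    using ip_avg_avg[OF closed(2) b_p, of u u] by (simp_all add: ip_commute)
  \<comment> \<open>If \<open>x\<close> and \<open>y\<close> have equal norms and cosine \<open>e\<close>, then \<open>al\<close> times \<open>x + y\<close> is the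
    vector of their span nearest to \<open>u\<close>.\<close>
  define al where "al = 1 / (1 + e)"
  have "0 \<le> ip (\<lambda>g. u g - al * (x g + y g)) (\<lambda>g. u g - al * (x g + y g))" by (rule ip_ge_0)
  also have "\<dots> = n - 2 * al * (A + B) + al\<^sup>2 * (A + B + 2 * K)"
    using ux uy by (simp add: ip_linear n_def A_def B_def K_def ip_commute[of y x] power2_eq_square algebra_simps)
  finally have n: "0 \<le> n - 2 * al * (A + B) + al\<^sup>2 * (A + B + 2 * K)" .
  have al: "(1 + e) * al = 1" using e by (simp add: al_def)
  have "0 \<le> (1 + e) * (n - 2 * al * (A + B) + al\<^sup>2 * (A + B + 2 * K))"
    using n e by simp
  also have "\<dots> = (1 + e) * n - 2 * ((1 + e) * al) * (A + B) + ((1 + e) * al) * al * (A + B + 2 * K)"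
    by (simp add: power2_eq_square algebra_simps)
  finally have n2: "0 \<le> (1 + e) * n - 2 * (A + B) + al * (A + B + 2 * K)" unfolding al by simp
  have "0 \<le> (1 - e) * al * (e * (A + B) - 2 * K)"
    using K e by (simp add: al_def)
  also have "\<dots> = 2 * (A + B) - e * (A + B) + 2 * K - 2 * al * (A + B + 2 * K)"
    using e unfolding al_def by (simp add: divide_simps) (simp add: algebra_simps)
  finally have n3: "0 \<le> 2 * (A + B) - e * (A + B) + 2 * K - 2 * al * (A + B + 2 * K)" .
  have goal: "- e * ((n - A) + (n - B)) \<le> 2 * (n - A - B + K)"
    using n2 n3 by (simp add: algebra_simps)
  have qa: "v g - avg a v g = u g - x g" if "g \<in> carrier G" for g using ax[OF that] by (simp add: u_def)
  have qb: "v g - avg b v g = u g - y g" if "g \<in> carrier G" for g using ay[OF that] by (simp add: u_def)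
  have 1: "ip (\<lambda>g. v g - avg a v g) (\<lambda>g. v g - avg a v g) = n - A"
  proof -
    have "ip (\<lambda>g. v g - avg a v g) (\<lambda>g. v g - avg a v g) = ip (\<lambda>g. u g - x g) (\<lambda>g. u g - x g)"
      by (rule ip_cong) (simp_all add: qa)
    thus ?thesis by (simp add: ip_diff_left ip_diff_right ux A_def[symmetric] n_def)
  qed
  have 2: "ip (\<lambda>g. v g - avg b v g) (\<lambda>g. v g - avg b v g) = n - B"
  proof -
    have "ip (\<lambda>g. v g - avg b v g) (\<lambda>g. v g - avg b v g) = ip (\<lambda>g. u g - y g) (\<lambda>g. u g - y g)"
      by (rule ip_cong) (simp_all add: qb)
    thus ?thesis by (simp add: ip_diff_left ip_diff_right uy B_def[symmetric] n_def)
  qed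
  have 3: "ip (\<lambda>g. v g - avg a v g) (\<lambda>g. v g - avg b v g) = n - A - B + K"
  proof -
    have "ip (\<lambda>g. v g - avg a v g) (\<lambda>g. v g - avg b v g) = ip (\<lambda>g. u g - x g) (\<lambda>g. u g - y g)"
      by (rule ip_cong) (simp_all add: qa qb)
    thus ?thesis by (simp add: ip_diff_left ip_diff_right ux uy K_def[symmetric] n_def)
  qed
  show ?thesis unfolding 1 2 3 using goal by (simp add: e_def)
qed

end

section \<open>Spectral gap from pairwise angles\<close>

lemma sum_squared_le_card_mult:
  fixes x :: "'i \<Rightarrow> real"
  shows "(\<Sum>i\<in>I. x i)\<^sup>2 \<le> real (card I) * (\<Sum>i\<in>I. (x i)\<^sup>2)"
proof -
  have "\<bar>\<Sum>i\<in>I. x i\<bar> \<le> (\<Sum>i\<in>I. \<bar>x i\<bar> * \<bar>1\<bar>)" using sum_abs[of x I] by simp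
  also have "\<dots> \<le> L2_set x I * L2_set (\<lambda>_. 1) I" by (rule L2_set_mult_ineq)
  finally have "\<bar>\<Sum>i\<in>I. x i\<bar>\<^sup>2 \<le> (L2_set x I * L2_set (\<lambda>_. 1) I)\<^sup>2"
    by (rule power_mono) simp
  thus ?thesis by (simp add: power_mult_distrib L2_set_def sum_nonneg mult.commute)
qed

text \<open>
  The pairwise estimate of the previous section, with a constant \<open>e\<close> that is small compared with
  the number of generators.
\<close>

locale generated_by_exponent = finite_group_of_exponent +
  fixes I :: "'i set" and a :: "'i \<Rightarrow> 'a" and e :: real
  assumes I: "finite I" "I \<noteq> {}"
    and a_closed: "\<And>i. i \<in> I \<Longrightarrow> a i \<in> carrier G"
    and a_p: "\<And>i. i \<in> I \<Longrightarrow> a i [^] p = \<one>"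
    and generates: "generate G (a ` I) = carrier G"
    and e: "0 \<le> e" "(real (card I) - 1) * e < 1"
    and almost_orthogonal: "\<And>i j v. \<lbrakk>i \<in> I; j \<in> I; i \<noteq> j\<rbrakk> \<Longrightarrow>
       - e * (ip (\<lambda>g. v g - avg (a i) v g) (\<lambda>g. v g - avg (a i) v g)
            + ip (\<lambda>g. v g - avg (a j) v g) (\<lambda>g. v g - avg (a j) v g))
       \<le> 2 * ip (\<lambda>g. v g - avg (a i) v g) (\<lambda>g. v g - avg (a j) v g)"
begin

definition defect :: "'i \<Rightarrow> ('a \<Rightarrow> real) \<Rightarrow> 'a \<Rightarrow> real" where
  "defect i v g = v g - avg (a i) v g"

definition laplacian :: "('a \<Rightarrow> real) \<Rightarrow> 'a \<Rightarrow> real" where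
  "laplacian v g = (\<Sum>i\<in>I. defect i v g)"

definition energy :: "('a \<Rightarrow> real) \<Rightarrow> real" where
  "energy v = (\<Sum>i\<in>I. ip (defect i v) (defect i v))"

definition step :: "('a \<Rightarrow> real) \<Rightarrow> 'a \<Rightarrow> real" where
  "step v g = v g - laplacian v g / card I"

definition gap :: real where
  "gap = 1 - (real (card I) - 1) * e"

definition ratio :: real where
  "ratio = 1 - gap / card I"

lemma card_I: "0 < card I" using I by (simp add: card_gt_0_iff)

lemma defect_alt: "defect i v = (\<lambda>g. v g - avg (a i) v g)" by (simp add: defect_def fun_eq_iff)

lemma laplacian_alt: "laplacian v = (\<lambda>g. \<Sum>i\<in>I. defect i v g)" by (simp add: laplacian_def fun_eq_iff)

lemma step_alt: "step v = (\<lambda>g. v g - laplacian v g / card I)" by (simp add: step_def fun_eq_iff)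

lemma ip_defect: "i \<in> I \<Longrightarrow> ip (defect i v) (defect i v) = ip (defect i v) v"
  using ip_avg_avg[OF a_closed a_p, of i v v] ip_commute[of v "avg (a i) v"]
  by (simp add: defect_alt ip_diff_left ip_diff_right)

lemma defect_self_adjoint: "i \<in> I \<Longrightarrow> ip (defect i v) w = ip v (defect i w)"
  using avg_self_adjoint[OF a_closed a_p, of i v w] by (simp add: defect_alt ip_diff_left ip_diff_right)

lemma ip_defect_le: "i \<in> I \<Longrightarrow> ip (defect i v) (defect i v) \<le> ip v v"
  using ip_defect[of i v] ip_avg_avg[OF a_closed a_p, of i v v] ip_ge_0[of "avg (a i) v"]
  by (simp add: defect_alt ip_diff_left ip_diff_right) (simp add: ip_commute)

lemma laplacian_self_adjoint: "ip (laplacian v) w = ip v (laplacian w)"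
  by (simp add: laplacian_alt ip_sum_left ip_sum_right defect_self_adjoint)

lemma energy_eq: "energy v = ip (laplacian v) v"
  by (simp add: energy_def laplacian_alt ip_sum_left ip_defect)

lemma energy_nonneg: "0 \<le> energy v"
  unfolding energy_def by (intro sum_nonneg ip_ge_0)

lemma energy_le: "energy v \<le> card I * ip v v"
  unfolding energy_def using sum_mono[of I "\<lambda>i. ip (defect i v) (defect i v)" "\<lambda>_. ip v v"] ip_defect_le by simp

text \<open>
  Expanding \<open>ip (laplacian v) (laplacian v)\<close>, each off-diagonal pair of terms costs at most \<open>e\<close>
  times the corresponding two diagonal terms, and each diagonal term occurs in \<open>card I - 1\<close> pairs.
  As an operator inequality this says that the square of the Laplacian dominates \<open>gap\<close> times the
  Laplacian, so that no eigenvalue lies strictly between \<open>0\<close> and \<open>gap\<close>.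
\<close>

lemma laplacian_gap: "gap * energy v \<le> ip (laplacian v) (laplacian v)"
proof -
  define N where "N i = ip (defect i v) (defect i v)" for i
  have "ip (laplacian v) (laplacian v) = (\<Sum>i\<in>I. \<Sum>j\<in>I. ip (defect i v) (defect j v))"
    by (simp add: laplacian_alt ip_sum_left ip_sum_right)
  also have "\<dots> \<ge> (\<Sum>i\<in>I. \<Sum>j\<in>I. (if i = j then (1 + e) * N i else 0) - e / 2 * (N i + N j))"
  proof (intro sum_mono)
    fix i j assume "i \<in> I" "j \<in> I"
    thus "(if i = j then (1 + e) * N i else 0) - e / 2 * (N i + N j) \<le> ip (defect i v) (defect j v)"
      using almost_orthogonal[of i j v] by (auto simp: N_def defect_alt[symmetric] algebra_simps)
  qed
  also have "(\<Sum>i\<in>I. \<Sum>j\<in>I. (if i = j then (1 + e) * N i else 0) - e / 2 * (N i + N j))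
      = (1 + e) * (\<Sum>i\<in>I. N i) - e * card I * (\<Sum>i\<in>I. N i)"
  proof -
    have "(\<Sum>i\<in>I. \<Sum>j\<in>I. e / 2 * (N i + N j)) = e * card I * (\<Sum>i\<in>I. N i)"
      by (simp add: sum_distrib_left[symmetric] sum.distrib distrib_left sum_divide_distrib[symmetric])
    moreover have "(\<Sum>i\<in>I. \<Sum>j\<in>I. if i = j then (1 + e) * N i else 0) = (1 + e) * (\<Sum>i\<in>I. N i)"
      using I by (simp add: sum_distrib_left)
    ultimately show ?thesis by (simp add: sum_subtractf)
  qed
  also have "\<dots> = gap * energy v" by (simp add: gap_def energy_def N_def algebra_simps)
  finally show ?thesis .
qed

lemma laplacian_norm_le: "ip (laplacian v) (laplacian v) \<le> card I * energy v"
proof -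
  have "ip (laplacian v) (laplacian v) = (\<Sum>g\<in>carrier G. (\<Sum>i\<in>I. defect i v g)\<^sup>2)"
    by (simp add: ip_def laplacian_def power2_eq_square)
  also have "\<dots> \<le> (\<Sum>g\<in>carrier G. card I * (\<Sum>i\<in>I. (defect i v g)\<^sup>2))"
    by (intro sum_mono sum_squared_le_card_mult)
  also have "\<dots> = card I * energy v"
    unfolding energy_def ip_def
    by (simp add: sum_distrib_left[symmetric] power2_eq_square) (rule disjI2, rule sum.swap)
  finally show ?thesis .
qed

lemma defect_diff: "defect i (\<lambda>g. f g - h g) g = defect i f g - defect i h g"
  by (simp add: defect_def avg_diff)

lemma defect_divide: "defect i (\<lambda>g. f g / r) g = defect i f g / r"
  by (simp add: defect_def avg_divide diff_divide_distrib)

lemma laplacian_step: "laplacian (step v) = (\<lambda>g. laplacian v g - laplacian (laplacian v) g / card I)"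
proof
  fix g
  have "defect i (step v) g = defect i v g - defect i (laplacian v) g / card I" for i
    unfolding step_alt using defect_diff[of i v "\<lambda>g. laplacian v g / card I" g] defect_divide by simp
  thus "laplacian (step v) g = laplacian v g - laplacian (laplacian v) g / card I"
    by (simp add: laplacian_def[of _ g] sum_subtractf sum_divide_distrib)
qed

text \<open>
  A step replaces \<open>v\<close> by the mean of its averages over the generators. The bound on the energy comes
  from \<open>laplacian_gap\<close>; iterating it replaces the diagonalisation of the Laplacian.
\<close>

lemma energy_step: "energy (step v) \<le> ratio * energy v"
proof -
  define n where "n = real (card I)"
  define D where "D = ip (laplacian v) (laplacian v)"
  have n: "n \<ge> 1" using card_I by (simp add: n_def)
  have "energy (step v) = energy v - 2 * D / n + energy (laplacian v) / n\<^sup>2"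
    unfolding energy_eq laplacian_step unfolding step_alt
    using laplacian_self_adjoint[of "laplacian v" v]
    by (simp add: ip_diff_left ip_diff_right ip_divide_left ip_divide_right D_def n_def[symmetric]
        power2_eq_square diff_divide_distrib)
  also have "energy (laplacian v) / n\<^sup>2 \<le> n * D / n\<^sup>2"
    by (rule divide_right_mono) (use energy_le[of "laplacian v"] in \<open>auto simp: D_def n_def\<close>)
  also have "n * D / n\<^sup>2 = D / n" using n by (simp add: power2_eq_square)
  also have "energy v - 2 * D / n + D / n \<le> energy v - gap * energy v / n"
    using laplacian_gap[of v] n by (simp add: D_def field_simps)
  also have "\<dots> = ratio * energy v" by (simp add: ratio_def n_def algebra_simps)
  finally show ?thesis by simp
qed

lemma gap_bounds: "0 < gap" "gap \<le> 1"
proof -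
  show "0 < gap" using e by (simp add: gap_def)
  have "0 \<le> (real (card I) - 1) * e" using e card_I by (intro mult_nonneg_nonneg) auto
  thus "gap \<le> 1" by (simp add: gap_def)
qed

lemma ratio_bounds: "0 \<le> ratio" "ratio < 1"
  using gap_bounds card_I by (auto simp: ratio_def field_simps)

definition iterate :: "('a \<Rightarrow> real) \<Rightarrow> nat \<Rightarrow> 'a \<Rightarrow> real" where
  "iterate v k = (step ^^ k) v"

lemma iterate_0_Suc [simp]: "iterate v 0 = v" "iterate v (Suc k) = step (iterate v k)"
  by (simp_all add: iterate_def)

lemma energy_iterate: "energy (iterate v k) \<le> ratio ^ k * energy v"
proof (induction k)
  case (Suc k)
  have "energy (iterate v (Suc k)) \<le> ratio * energy (iterate v k)" by (simp add: energy_step)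
  also have "\<dots> \<le> ratio * (ratio ^ k * energy v)"
    by (intro mult_left_mono Suc ratio_bounds)
  finally show ?case by (simp add: mult.assoc)
qed simp

lemma iterate_increment:
  "L2_set (\<lambda>g. iterate v (Suc k) g - iterate v k g) (carrier G) \<le> sqrt (energy v) * sqrt ratio ^ k"
proof -
  define w where "w = iterate v k"
  define n where "n = real (card I)"
  have n: "n \<ge> 1" using card_I by (simp add: n_def)
  have "ip (\<lambda>g. step w g - w g) (\<lambda>g. step w g - w g) = ip (laplacian w) (laplacian w) / n\<^sup>2"
    by (simp add: step_def ip_def n_def sum_divide_distrib power2_eq_square)
  also have "\<dots> \<le> n * energy w / n\<^sup>2"
    by (rule divide_right_mono) (use laplacian_norm_le[of w] in \<open>auto simp: n_def\<close>)
  also have "\<dots> \<le> energy w"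
    using n energy_nonneg[of w] by (simp add: power2_eq_square divide_le_eq mult_le_cancel_left1)
  also have "\<dots> \<le> ratio ^ k * energy v" unfolding w_def by (rule energy_iterate)
  finally show ?thesis
    by (simp add: L2_set_eq_sqrt_ip w_def real_sqrt_mult[symmetric] real_sqrt_power[symmetric] mult.commute)
qed

lemma iterate_distance:
  "L2_set (\<lambda>g. iterate v k g - v g) (carrier G) \<le> sqrt (energy v) / (1 - sqrt ratio)"
proof -
  have s: "0 \<le> sqrt ratio" "sqrt ratio < 1" using ratio_bounds by auto
  have "L2_set (\<lambda>g. iterate v k g - v g) (carrier G) \<le> (\<Sum>j<k. sqrt (energy v) * sqrt ratio ^ j)"
  proof (induction k)
    case (Suc k)
    have "L2_set (\<lambda>g. iterate v (Suc k) g - v g) (carrier G)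
        = L2_set (\<lambda>g. (iterate v k g - v g) + (iterate v (Suc k) g - iterate v k g)) (carrier G)"
      by (rule L2_set_cong) auto
    also have "\<dots> \<le> L2_set (\<lambda>g. iterate v k g - v g) (carrier G)
        + L2_set (\<lambda>g. iterate v (Suc k) g - iterate v k g) (carrier G)" by (rule L2_set_triangle_ineq)
    finally show ?case using Suc iterate_increment[of v k] by simp
  qed (simp add: L2_set_def)
  also have "\<dots> = sqrt (energy v) * ((1 - sqrt ratio ^ k) / (1 - sqrt ratio))"
    using s by (simp add: sum_distrib_left[symmetric] sum_gp_strict)
  also have "\<dots> \<le> sqrt (energy v) * (1 / (1 - sqrt ratio))"
    using s energy_nonneg[of v] by (intro mult_left_mono divide_right_mono) auto
  finally show ?thesis by simp
qed

lemma iterate_convergent: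
  assumes "g \<in> carrier G"
  shows "convergent (\<lambda>k. iterate v k g)"
proof -
  have s: "0 \<le> sqrt ratio" "sqrt ratio < 1" using ratio_bounds by auto
  have "summable (\<lambda>k. iterate v (Suc k) g - iterate v k g)"
  proof (rule summable_comparison_test')
    show "summable (\<lambda>k. sqrt (energy v) * sqrt ratio ^ k)"
      using s by (intro summable_mult summable_geometric) auto
    fix k
    show "norm (iterate v (Suc k) g - iterate v k g) \<le> sqrt (energy v) * sqrt ratio ^ k"
    proof -
      have "\<bar>iterate v (Suc k) g - iterate v k g\<bar>
          \<le> L2_set (\<lambda>g. \<bar>iterate v (Suc k) g - iterate v k g\<bar>) (carrier G)"
        using member_le_L2_set[OF fin assms] .
      also have "\<dots> = L2_set (\<lambda>g. iterate v (Suc k) g - iterate v k g) (carrier G)"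
        by (simp add: L2_set_def)
      finally show ?thesis using iterate_increment[of v k] by simp
    qed
  qed
  hence "convergent (\<lambda>n. (\<Sum>k<n. iterate v (Suc k) g - iterate v k g) + v g)"
    by (intro convergent_add convergent_const) (simp add: summable_iff_convergent)
  moreover have "(\<Sum>k<n. iterate v (Suc k) g - iterate v k g) + v g = iterate v n g" for n
    by (subst sum_lessThan_telescope) simp
  ultimately show ?thesis by simp
qed

lemma sum_iterate: "(\<Sum>g\<in>carrier G. iterate v k g) = (\<Sum>g\<in>carrier G. v g)"
proof (induction k)
  case (Suc k)
  have "(\<Sum>g\<in>carrier G. laplacian w g) = 0" for w
    unfolding laplacian_def by (subst sum.swap) (simp add: defect_def sum_subtractf sum_avg a_closed)
  thus ?case using Suc by (simp add: step_def sum_subtractf sum_divide_distrib[symmetric])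
qed simp

lemma fixed_is_constant:
  assumes "\<And>i. i \<in> I \<Longrightarrow> right_invariant (a i) u" "x \<in> carrier G"
  shows "right_invariant x u"
proof -
  have "x \<in> generate G (a ` I)" using assms(2) generates by simp
  thus ?thesis
  proof induction
    case one thus ?case by (simp add: right_invariant_def)
  next
    case (incl h) thus ?case using assms(1) by auto
  next
    case (inv h)
    hence h: "h \<in> carrier G" "right_invariant h u" using assms(1) a_closed by auto
    show ?case unfolding right_invariant_def
    proof
      fix g assume "g \<in> carrier G"
      thus "u (g \<otimes> inv h) = u g"
        using h unfolding right_invariant_def by (metis inv_closed inv_solve_right m_closed)
    qed
  next
    case (eng h1 h2)
    have "h1 \<in> carrier G" "h2 \<in> carrier G" using eng generates by auto
    thus ?case using eng by (auto simp: right_invariant_def m_assoc[symmetric])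
  qed
qed

text \<open>
  The iterates converge, at a total distance controlled by the energy of \<open>v\<close>, to a function of energy
  zero. Such a function is invariant under all generators, hence constant, hence zero because steps
  preserve the mean.
\<close>

theorem spectral_gap:
  assumes mean: "(\<Sum>g\<in>carrier G. v g) = 0"
  shows "(1 - sqrt ratio)\<^sup>2 * ip v v \<le> energy v"
proof -
  have s: "0 \<le> sqrt ratio" "sqrt ratio < 1" using ratio_bounds by auto
  define u where "u g = lim (\<lambda>k. iterate v k g)" for g
  have lim: "(\<lambda>k. iterate v k g) \<longlonglongrightarrow> u g" if "g \<in> carrier G" for g
    using iterate_convergent[OF that] unfolding u_def by (simp add: convergent_LIMSEQ_iff)
  have limQ: "(\<lambda>k. defect i (iterate v k) g) \<longlonglongrightarrow> defect i u g" if "g \<in> carrier G" "i \<in> I" for g i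
    unfolding defect_def avg_def using that a_closed p_pos by (intro tendsto_intros lim) auto
  have "(\<lambda>k. energy (iterate v k)) \<longlonglongrightarrow> energy u"
    unfolding energy_def ip_def using limQ by (intro tendsto_intros) auto
  moreover have "(\<lambda>k. energy (iterate v k)) \<longlonglongrightarrow> 0"
  proof (rule tendsto_sandwich[OF _ _ tendsto_const])
    show "(\<lambda>k. ratio ^ k * energy v) \<longlonglongrightarrow> 0"
      using ratio_bounds by (intro tendsto_mult_left_zero LIMSEQ_power_zero) auto
  qed (auto simp: energy_nonneg energy_iterate)
  ultimately have "energy u = 0" using LIMSEQ_unique by blast
  hence "ip (defect i u) (defect i u) = 0" if "i \<in> I" for i
    using that I by (simp add: energy_def sum_nonneg_eq_0_iff ip_ge_0)
  hence Qu: "defect i u g = 0" if "i \<in> I" "g \<in> carrier G" for i g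
    using that fin by (auto simp: ip_def sum_nonneg_eq_0_iff)
  have "right_invariant (a i) u" if i: "i \<in> I" for i
    using right_invariant_avg[OF a_closed[OF i] a_p[OF i], of u] Qu[OF i] a_closed[OF i]
    by (simp add: right_invariant_def defect_def)
  hence const: "u x = u \<one>" if "x \<in> carrier G" for x
    using fixed_is_constant[of u x] that unfolding right_invariant_def by (metis l_one one_closed)
  have "(\<lambda>k. \<Sum>g\<in>carrier G. iterate v k g) \<longlonglongrightarrow> (\<Sum>g\<in>carrier G. u g)"
    using lim by (intro tendsto_intros) auto
  hence "(\<Sum>g\<in>carrier G. u g) = 0" unfolding sum_iterate mean using LIMSEQ_unique tendsto_const by blast
  moreover have "(\<Sum>g\<in>carrier G. u g) = (\<Sum>g\<in>carrier G. u \<one>)" by (rule sum.cong[OF refl const])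
  ultimately have "real (card (carrier G)) * u \<one> = 0" by simp
  hence u0: "u x = 0" if "x \<in> carrier G" for x
    using const[OF that] fin that by (auto simp: card_eq_0_iff)
  have "(\<lambda>k. L2_set (\<lambda>g. iterate v k g - v g) (carrier G)) \<longlonglongrightarrow> L2_set (\<lambda>g. u g - v g) (carrier G)"
    unfolding L2_set_def using lim by (intro tendsto_intros) auto
  hence "L2_set (\<lambda>g. u g - v g) (carrier G) \<le> sqrt (energy v) / (1 - sqrt ratio)"
    using iterate_distance by (intro LIMSEQ_le_const2) auto
  moreover have "L2_set (\<lambda>g. u g - v g) (carrier G) = sqrt (ip v v)"
    using u0 by (simp add: L2_set_def ip_def power2_eq_square)
  ultimately have "(1 - sqrt ratio) * sqrt (ip v v) \<le> sqrt (energy v)"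
    using s by (simp add: field_simps)
  hence "((1 - sqrt ratio) * sqrt (ip v v))\<^sup>2 \<le> (sqrt (energy v))\<^sup>2"
    using s ip_ge_0 by (intro power_mono mult_nonneg_nonneg) auto
  thus ?thesis by (simp add: power_mult_distrib ip_ge_0 energy_nonneg)
qed

section \<open>Vertex expansion\<close>

definition powers :: "'a set" where
  "powers = (\<lambda>(i, k). a i [^] (k::nat)) ` (I \<times> {..<p})"

lemma powers_closed: "powers \<subseteq> carrier G"
  unfolding powers_def using a_closed by auto

lemma card_powers: "card powers \<le> card I * p"
  unfolding powers_def using card_image_le[of "I \<times> {..<p}"] I by (simp add: card_cartesian_product)

lemma generating_powers:
  assumes "1 < p"
  shows "generating_set G powers"
proof -
  have "a i \<in> powers" if "i \<in> I" for i
    unfolding powers_def using that assms a_closed by (intro image_eqI[of _ _ "(i, 1)"]) auto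
  hence "generate G (a ` I) \<subseteq> generate G powers" by (intro mono_generate) auto
  thus ?thesis using generates generate_incl[OF powers_closed] powers_closed
    unfolding generating_set_def by auto
qed

lemma sum_indicator:
  assumes "X \<subseteq> carrier G"
  shows "(\<Sum>g\<in>carrier G. indicat_real X g) = real (card X)"
proof -
  have "carrier G \<inter> {g. g \<in> X} = X" using assms by auto
  thus ?thesis using fin by (simp add: indicator_def sum.If_cases)
qed

text \<open>
  A point where the indicator functions of \<open>A\<close> and of its translate by \<open>x\<close> differ either is a boundary
  vertex or is carried to one by \<open>x\<close>, and right translation is injective.
\<close>

lemma difference_le_boundary:
  assumes A: "A \<subseteq> carrier G" and x: "x \<in> powers"
  shows "(\<Sum>g\<in>carrier G. (indicat_real A g - indicat_real A (g \<otimes> x))\<^sup>2)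
     \<le> 2 * real (card (vertex_boundary (cayley_graph G powers) A))"
proof -
  define B where "B = vertex_boundary (cayley_graph G powers) A"
  have finB: "finite B" using fin by (simp add: B_def vertex_boundary_def cayley_graph_def)
  have xc: "x \<in> carrier G" using x powers_closed by auto
  define X where "X = {g \<in> carrier G. g \<notin> A \<and> g \<otimes> x \<in> A}"
  define Y where "Y = {g \<in> carrier G. g \<in> A \<and> g \<otimes> x \<notin> A}"
  have "X \<subseteq> B" unfolding X_def B_def vertex_boundary_def cayley_graph_def using x A by fastforce
  hence X: "card X \<le> card B" using finB by (simp add: card_mono)
  have "card Y = card ((\<lambda>g. g \<otimes> x) ` Y)"
    by (rule card_image[symmetric]) (auto simp: inj_on_def Y_def xc)
  also have "(\<lambda>g. g \<otimes> x) ` Y \<subseteq> B"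
    unfolding Y_def B_def vertex_boundary_def cayley_graph_def using x A xc by fastforce
  hence "card ((\<lambda>g. g \<otimes> x) ` Y) \<le> card B" using finB by (simp add: card_mono)
  finally have Y: "card Y \<le> card B" .
  have "(\<Sum>g\<in>carrier G. (indicat_real A g - indicat_real A (g \<otimes> x))\<^sup>2)
      = (\<Sum>g\<in>carrier G. indicat_real X g + indicat_real Y g)"
    by (rule sum.cong) (auto simp: X_def Y_def indicator_def)
  also have "\<dots> = card X + card Y"
    using sum_indicator[of X] sum_indicator[of Y] by (simp add: sum.distrib X_def Y_def)
  finally show ?thesis using X Y by (simp add: B_def)
qed

text \<open>
  The spectral gap is applied to the indicator function of \<open>A\<close> minus its mean. As \<open>A\<close> fills at most half
  of the group, the squared norm of this function is at least \<open>card A / 2\<close>.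
\<close>

theorem powers_expand:
  assumes A: "A \<subseteq> carrier G" "real (card A) \<le> real (card (carrier G)) / 2"
  shows "(1 - sqrt ratio)\<^sup>2 / (4 * card I) * card A
           \<le> card (vertex_boundary (cayley_graph G powers) A)"
proof -
  define b where "b = real (card (vertex_boundary (cayley_graph G powers) A))"
  define n where "n = real (card (carrier G))"
  define m where "m = real (card A) / n"
  have n: "n > 0" using fin by (simp add: n_def card_gt_0_iff) auto
  define v where "v g = indicat_real A g - m" for g
  have sA: "(\<Sum>g\<in>carrier G. indicat_real A g) = real (card A)"
    by (rule sum_indicator[OF A(1)])
  have mean: "(\<Sum>g\<in>carrier G. v g) = 0"
    using sA n by (simp add: v_def sum_subtractf m_def n_def[symmetric])
  have "ip v v = (\<Sum>g\<in>carrier G. (1 - 2 * m) * indicat_real A g + m * m)"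
    unfolding ip_def v_def by (rule sum.cong) (auto simp: indicator_def algebra_simps)
  also have "\<dots> = (1 - 2 * m) * card A + n * (m * m)"
    using sA by (simp add: sum.distrib sum_distrib_left[symmetric] n_def)
  also have "\<dots> = card A * (1 - m)" using n by (simp add: m_def field_simps)
  also have "\<dots> \<ge> card A * (1 / 2)"
    using A n by (intro mult_left_mono) (auto simp: m_def n_def field_simps)
  finally have ipv: "card A / 2 \<le> ip v v" by simp
  have Qb: "ip (defect i v) (defect i v) \<le> 2 * b" if i: "i \<in> I" for i
  proof -
    have Qg: "defect i v g = (\<Sum>k<p. v g - v (g \<otimes> a i [^] k)) / p" for g
      using p_pos by (simp add: defect_def avg_def sum_subtractf field_simps)
    have Qsq: "(defect i v g)\<^sup>2 \<le> (\<Sum>k<p. (v g - v (g \<otimes> a i [^] k))\<^sup>2) / p" for g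
    proof -
      have "(defect i v g)\<^sup>2 = (\<Sum>k<p. v g - v (g \<otimes> a i [^] k))\<^sup>2 / (real p)\<^sup>2"
        by (simp only: Qg power_divide)
      also have "\<dots> \<le> (real p * (\<Sum>k<p. (v g - v (g \<otimes> a i [^] k))\<^sup>2)) / (real p)\<^sup>2"
        using sum_squared_le_card_mult[of "\<lambda>k. v g - v (g \<otimes> a i [^] k)" "{..<p}"]
        by (intro divide_right_mono) auto
      finally show ?thesis using p_pos by (simp add: power2_eq_square)
    qed
    have "ip (defect i v) (defect i v) \<le> (\<Sum>g\<in>carrier G. (\<Sum>k<p. (v g - v (g \<otimes> a i [^] k))\<^sup>2) / p)"
      unfolding ip_def by (intro sum_mono) (use Qsq in \<open>simp add: power2_eq_square\<close>)
    also have "\<dots> = (\<Sum>k<p. \<Sum>g\<in>carrier G. (v g - v (g \<otimes> a i [^] k))\<^sup>2) / p"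
      by (subst sum.swap) (simp add: sum_divide_distrib)
    also have "\<dots> \<le> (\<Sum>k<p. 2 * b) / p"
    proof (intro divide_right_mono sum_mono)
      fix k assume "k \<in> {..<p}"
      hence "a i [^] k \<in> powers" unfolding powers_def using i by auto
      thus "(\<Sum>g\<in>carrier G. (v g - v (g \<otimes> a i [^] k))\<^sup>2) \<le> 2 * b"
        using difference_le_boundary[OF A(1)] by (simp add: v_def b_def)
    qed simp
    also have "\<dots> = 2 * b" using p_pos by simp
    finally show ?thesis .
  qed
  have "energy v \<le> card I * (2 * b)"
    unfolding energy_def using sum_mono[of I "\<lambda>i. ip (defect i v) (defect i v)" "\<lambda>_. 2 * b"] Qb by simp
  moreover have "(1 - sqrt ratio)\<^sup>2 * (card A / 2) \<le> (1 - sqrt ratio)\<^sup>2 * ip v v"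
    by (rule mult_left_mono[OF ipv]) simp
  ultimately have "(1 - sqrt ratio)\<^sup>2 * (card A / 2) \<le> card I * (2 * b)"
    using spectral_gap[OF mean] by linarith
  thus ?thesis using card_I by (simp add: b_def field_simps)
qed

end

lemma pair_pseudo_graph_cayley_graph:
  assumes "finite (carrier G)"
  shows "pair_pseudo_graph (cayley_graph G F)"
proof
  show "finite (parcs (cayley_graph G F))"
    by (rule finite_subset[of _ "carrier G \<times> carrier G"]) (use assms in \<open>auto simp: cayley_graph_def\<close>)
  show "symmetric (with_proj (cayley_graph G F))"
    unfolding symmetric_def by (auto simp: sym_def cayley_graph_def arcs_ends_def arc_to_ends_def)
qed (use assms in \<open>auto simp: cayley_graph_def\<close>)

section \<open>Groups containing all 3-cycles\<close>

lemma cycle3_apply: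
  assumes "distinct [x, y, z]"
  shows "cycle_of_list [x, y, z] x = y" "cycle_of_list [x, y, z] y = z" "cycle_of_list [x, y, z] z = x"
    "u \<notin> {x, y, z} \<Longrightarrow> cycle_of_list [x, y, z] u = u"
  using assms by (auto simp: transpose_def)

lemma cycle3_rotate:
  assumes "distinct [x, y, z]"
  shows "cycle_of_list [y, z, x] = cycle_of_list [x, y, z]"
  using assms by (auto simp: fun_eq_iff transpose_def)

lemma cycle3_inv:
  assumes "distinct [x, y, z]"
  shows "inv' (cycle_of_list [x, y, z]) = cycle_of_list [x, z, y]"
  by (rule inv_unique_comp) (use assms in \<open>auto simp: fun_eq_iff transpose_def\<close>)

text \<open>
  The source of 3-cycles: the commutator of two permutations whose supports share a single point.
\<close>

lemma commutator_eq_cycle3: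
  assumes s: "bij s" and t: "bij t"
    and supp: "\<And>u. s u \<noteq> u \<and> t u \<noteq> u \<longleftrightarrow> u = x"
  shows "distinct [x, s x, t x]" "s \<circ> t = cycle_of_list [x, s x, t x] \<circ> (t \<circ> s)"
proof -
  have si: "s u = s v \<longleftrightarrow> u = v" and ti: "t u = t v \<longleftrightarrow> u = v" for u v
    using s t by (simp_all add: bij_is_inj inj_eq)
  have sx: "s x \<noteq> x" and tx: "t x \<noteq> x" using supp by auto
  have ty: "t (s x) = s x" using supp[of "s x"] sx si by auto
  have sz: "s (t x) = t x" using supp[of "t x"] tx ti by auto
  have "s x \<noteq> t x" using sz sx si by metis
  thus d: "distinct [x, s x, t x]" using sx tx by auto
  have "s (t u) = cycle_of_list [x, s x, t x] (t (s u))" for u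
  proof -
    note c = cycle3_apply[OF d]
    consider "u = x" | "u \<noteq> x" "s u = x" | "u \<noteq> x" "t u = x"
      | "u \<noteq> x" "s u \<noteq> x" "t u \<noteq> x" by blast
    thus ?thesis
    proof cases
      case 1 thus ?thesis using ty sz c(2) by simp
    next
      case 2
      hence "t u = u" using supp[of u] by auto
      thus ?thesis using 2 c(3) by simp
    next
      case 3
      hence "s u = u" using supp[of u] by auto
      thus ?thesis using 3 c(1) by simp
    next
      case 4
      show ?thesis
      proof (cases "t u = u")
        case False
        have su: "s u = u" using supp[of u] False 4 by auto
        have stu: "s (t u) = t u" using supp[of "t u"] False 4 ti by auto
        have "t u \<noteq> s x" "t u \<noteq> t x" using su ty ti si sx 4 by metis+
        hence "t u \<notin> {x, s x, t x}" using 4 by simp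
        thus ?thesis using c(4)[of "t u"] su stu by simp
      next
        case tu: True
        show ?thesis
        proof (cases "s u = u")
          case True
          have "u \<noteq> s x" "u \<noteq> t x" using True tu sx tx si ti by metis+
          hence "u \<notin> {x, s x, t x}" using 4 by simp
          thus ?thesis using c(4)[of u] True tu by simp
        next
          case False
          have tsu: "t (s u) = s u" using supp[of "s u"] False 4 si by auto
          have "s u \<noteq> s x" "s u \<noteq> t x" using 4 False si sz tu tx by metis+
          hence "s u \<notin> {x, s x, t x}" using 4 by simp
          thus ?thesis using c(4)[of "s u"] tsu tu by simp
        qed
      qed
    qed
  qed
  thus "s \<circ> t = cycle_of_list [x, s x, t x] \<circ> (t \<circ> s)" by (simp add: fun_eq_iff)
qed

locale permutation_group =
  fixes H :: "('a \<Rightarrow> 'a) set"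
  assumes bij_H: "\<And>h. h \<in> H \<Longrightarrow> bij h"
    and comp_H: "\<And>g h. g \<in> H \<Longrightarrow> h \<in> H \<Longrightarrow> g \<circ> h \<in> H"
    and inv_H: "\<And>h. h \<in> H \<Longrightarrow> inv' h \<in> H"
begin

text \<open>
  To show that \<open>H\<close> contains all 3-cycles it is enough to link all pairs of points, and as linking is an
  equivalence relation it is enough to link the pairs of some connected graph.
\<close>

definition linked :: "'a \<Rightarrow> 'a \<Rightarrow> bool" where
  "linked x y \<longleftrightarrow> x = y \<or> (\<exists>z. distinct [x, y, z] \<and> cycle_of_list [x, y, z] \<in> H)"

lemma conj_cycle3:
  assumes "distinct [x, y, z]" "cycle_of_list [x, y, z] \<in> H" "h \<in> H"
  shows "distinct [h x, h y, h z]" "cycle_of_list [h x, h y, h z] \<in> H"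
proof -
  show "distinct [h x, h y, h z]" using assms(1) bij_H[OF assms(3)] by (simp add: bij_is_inj inj_eq)
  have "h \<circ> cycle_of_list [x, y, z] \<circ> inv' h \<in> H"
    by (intro comp_H inv_H assms)
  thus "cycle_of_list [h x, h y, h z] \<in> H"
    unfolding conjugation_of_cycle[OF assms(1) bij_H[OF assms(3)]] by (simp only: list.map)
qed

lemma inv_cycle3:
  assumes "distinct [x, y, z]" "cycle_of_list [x, y, z] \<in> H"
  shows "cycle_of_list [x, z, y] \<in> H"
  using inv_H[OF assms(2)] cycle3_inv[OF assms(1)] by simp

text \<open>
  If \<open>h\<close> is the 3-cycle that links \<open>b\<close> to \<open>c\<close>, then conjugation by \<open>h\<close> turns a 3-cycle through \<open>a\<close> and \<open>b\<close>
  into one through \<open>a\<close> and \<open>c\<close>, unless \<open>h\<close> moves \<open>a\<close>, in which case \<open>h\<close> itself links \<open>a\<close> to \<open>c\<close>.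
\<close>

lemma linked_trans:
  assumes "linked a b" "linked b c"
  shows "linked a c"
proof (cases "a = b \<or> b = c \<or> a = c")
  case True
  thus ?thesis using assms by (auto simp: linked_def)
next
  case False
  obtain d where d: "distinct [a, b, d]" "cycle_of_list [a, b, d] \<in> H"
    using assms(1) False by (auto simp: linked_def)
  obtain e where e: "distinct [b, c, e]" "cycle_of_list [b, c, e] \<in> H"
    using assms(2) False by (auto simp: linked_def)
  show ?thesis
  proof (cases "e = a")
    case True
    have "cycle_of_list [a, b, c] \<in> H" using e True cycle3_rotate[of a b c] by auto
    hence "cycle_of_list [a, c, b] \<in> H" using inv_cycle3[of a b c] e True by auto
    thus ?thesis using False unfolding linked_def by (intro disjI2 exI[of _ b]) auto
  next
    case ea: False
    define h where "h = cycle_of_list [b, c, e]"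
    have "h a = a" "h b = c" unfolding h_def
      using cycle3_apply[OF e(1)] False ea by auto
    thus ?thesis
      using conj_cycle3[OF d, of h] e(2) unfolding linked_def h_def by (intro disjI2 exI[of _ "h d"]) (auto simp: h_def)
  qed
qed

text \<open>
  A 3-cycle of \<open>H\<close> through \<open>a\<close> and \<open>b\<close> has some third point \<open>d\<close>, and a 3-cycle linking \<open>d\<close> to \<open>c\<close> conjugates it
  into the wanted one. If the latter passes through \<open>a\<close> or \<open>b\<close>, the two 3-cycles together act on the
  four points \<open>a\<close>, \<open>b\<close>, \<open>c\<close>, \<open>d\<close> only, and conjugating in the other direction finishes the proof.
\<close>

lemma cycle3_mem_if_linked:
  assumes abc: "distinct [a, b, c]" and all: "\<And>x y. x \<in> S \<Longrightarrow> y \<in> S \<Longrightarrow> linked x y"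
    and S: "a \<in> S" "b \<in> S" "c \<in> S" and fixS: "\<And>h x. h \<in> H \<Longrightarrow> x \<notin> S \<Longrightarrow> h x = x"
  shows "cycle_of_list [a, b, c] \<in> H"
proof -
  obtain d where d: "distinct [a, b, d]" "cycle_of_list [a, b, d] \<in> H"
    using all[OF S(1,2)] abc by (auto simp: linked_def)
  show ?thesis
  proof (cases "d = c")
    case True thus ?thesis using d by simp
  next
    case False
    have "d \<in> S"
      using fixS[OF d(2), of d] cycle3_apply(3)[OF d(1)] d(1) by auto
    hence "linked d c" using all S by blast
    then obtain e where e: "distinct [d, c, e]" "cycle_of_list [d, c, e] \<in> H"
      using False by (auto simp: linked_def)
    define h where "h = cycle_of_list [d, c, e]"
    define g where "g = cycle_of_list [a, b, d]"
    have g: "g a = b" "g b = d" "g d = a" "g c = c" unfolding g_def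
      using cycle3_apply[OF d(1)] abc False by auto
    have hd: "h d = c" unfolding h_def using cycle3_apply[OF e(1)] by auto
    consider "e = a" | "e = b" | "e \<notin> {a, b}" by blast
    thus ?thesis
    proof cases
      case 1
      have "cycle_of_list [g d, g c, g a] \<in> H"
        using conj_cycle3[of d c a g] e 1 d(2) by (simp add: g_def)
      hence "cycle_of_list [a, c, b] \<in> H" by (simp add: g)
      thus ?thesis using inv_cycle3[of a c b] abc by auto
    next
      case 2
      have *: "distinct [g d, g c, g b]" "cycle_of_list [g d, g c, g b] \<in> H"
        using conj_cycle3[of d c b g] e 2 d(2) by (simp_all add: g_def)
      hence "distinct [a, c, d]" "cycle_of_list [a, c, d] \<in> H" by (simp_all add: g)
      hence i: "distinct [a, d, c]" "cycle_of_list [a, d, c] \<in> H" using inv_cycle3 by auto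
      have "cycle_of_list [g a, g d, g c] \<in> H"
        using conj_cycle3[OF i, of g] d(2) by (simp add: g_def)
      hence "cycle_of_list [b, a, c] \<in> H" by (simp add: g)
      hence "cycle_of_list [b, c, a] \<in> H" using inv_cycle3[of b a c] abc by auto
      thus ?thesis using cycle3_rotate[OF abc] by simp
    next
      case 3
      hence "h a = a" "h b = b" unfolding h_def
        using cycle3_apply(4)[OF e(1)] abc d(1) by auto
      thus ?thesis using conj_cycle3[OF d, of h] e(2) hd by (simp add: h_def)
    qed
  qed
qed

end

section \<open>Shears and their commutators\<close>

text \<open>
  Points are vectors indexed by the natural numbers. A shear adds to some coordinates a function of
  other coordinates; which ones is recorded by \<open>writes\<close> and \<open>reads\<close>.
\<close>

definition shear :: "((nat \<Rightarrow> 'k) \<Rightarrow> nat \<Rightarrow> 'k::field) \<Rightarrow> (nat \<Rightarrow> 'k) \<Rightarrow> nat \<Rightarrow> 'k" where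
  "shear f u = (\<lambda>i. u i + f u i)"

definition writes :: "((nat \<Rightarrow> 'k) \<Rightarrow> nat \<Rightarrow> 'k::field) \<Rightarrow> nat set \<Rightarrow> bool" where
  "writes f W \<longleftrightarrow> (\<forall>u. \<forall>i. i \<notin> W \<longrightarrow> f u i = 0)"

definition reads :: "((nat \<Rightarrow> 'k) \<Rightarrow> 'b) \<Rightarrow> nat set \<Rightarrow> bool" where
  "reads f R \<longleftrightarrow> (\<forall>u v. (\<forall>i\<in>R. u i = v i) \<longrightarrow> f u = f v)"

definition single :: "nat \<Rightarrow> ((nat \<Rightarrow> 'k) \<Rightarrow> 'k::field) \<Rightarrow> (nat \<Rightarrow> 'k) \<Rightarrow> nat \<Rightarrow> 'k" where
  "single a \<phi> u = (\<lambda>i. if i = a then \<phi> u else 0)"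

text \<open>
  The vector added by the linear map that adds coordinate \<open>i + s\<close> to coordinate \<open>i\<close>, simultaneously for all
  \<open>i\<close> congruent to \<open>j\<close> modulo 3. Working modulo 3 keeps the coordinates that are read (for \<open>s\<close> equal to
  1 or 2) apart from those that are written.
\<close>

definition block :: "nat \<Rightarrow> nat \<Rightarrow> nat \<Rightarrow> (nat \<Rightarrow> 'k::field) \<Rightarrow> nat \<Rightarrow> 'k" where
  "block N s j u = (\<lambda>i. if i mod 3 = j mod 3 \<and> i + s < N then u (i + s) else 0)"

lemma readsD: "reads f R \<Longrightarrow> (\<And>i. i \<in> R \<Longrightarrow> u i = v i) \<Longrightarrow> f u = f v"
  by (simp add: reads_def)

lemma writes_mono: "writes f W \<Longrightarrow> W \<subseteq> W' \<Longrightarrow> writes f W'"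
  by (auto simp: writes_def)

lemma reads_shear:
  assumes "reads g R" "writes f W" "W \<inter> R = {}"
  shows "g (\<lambda>i. u i + c * f u i) = g u" "g (shear f u) = g u"
proof -
  show *: "g (\<lambda>i. u i + c * f u i) = g u" for c
    by (rule readsD[OF assms(1)]) (use assms(2,3) in \<open>auto simp: writes_def\<close>)
  show "g (shear f u) = g u" using *[of 1] by (simp add: shear_def)
qed

definition reads_off_writes :: "((nat \<Rightarrow> 'k) \<Rightarrow> nat \<Rightarrow> 'k::field) \<Rightarrow> bool" where
  "reads_off_writes f \<longleftrightarrow> (\<exists>W R. writes f W \<and> reads f R \<and> W \<inter> R = {})"

lemma shear_scale_compose:
  assumes "reads_off_writes f"
  shows "shear (\<lambda>u i. c * f u i) (shear (\<lambda>u i. d * f u i) u) = shear (\<lambda>u i. (c + d) * f u i) u"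
proof -
  obtain W R where "writes f W" "reads f R" "W \<inter> R = {}" using assms by (auto simp: reads_off_writes_def)
  hence "f (\<lambda>i. u i + d * f u i) = f u" by (intro reads_shear)
  thus ?thesis by (simp add: shear_def fun_eq_iff algebra_simps)
qed

lemma shear_zero: "shear (\<lambda>u i. 0 * f u i) = id"
  by (simp add: shear_def fun_eq_iff)

lemma shear_power:
  assumes "reads_off_writes f"
  shows "shear f ^^ m = shear (\<lambda>u i. of_nat m * f u i)"
proof (induction m)
  case (Suc m)
  have "shear f (shear (\<lambda>u i. of_nat m * f u i) u) = shear (\<lambda>u i. of_nat (Suc m) * f u i) u" for u
    using shear_scale_compose[OF assms, of 1 "of_nat m" u] by (simp add: algebra_simps)
  thus ?case unfolding funpow.simps Suc by (intro ext) (simp only: o_apply)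
qed (simp add: shear_def fun_eq_iff)

text \<open>
  The shear of \<open>h\<close> is the commutator of the shears of \<open>f\<close> and \<open>g\<close>, and it commutes with both. The condition
  is asymmetric: \<open>f\<close> may read what \<open>g\<close> writes, but not conversely, and \<open>h\<close> records how adding \<open>g u\<close> to
  \<open>u\<close> changes \<open>f u\<close>. The triple serves two purposes: it certifies that two generators span a group of
  class at most 2, and it produces new shears from old ones.
\<close>

definition heisenberg_triple :: "((nat \<Rightarrow> 'k) \<Rightarrow> nat \<Rightarrow> 'k) \<Rightarrow> ((nat \<Rightarrow> 'k) \<Rightarrow> nat \<Rightarrow> 'k) \<Rightarrow>
    ((nat \<Rightarrow> 'k) \<Rightarrow> nat \<Rightarrow> 'k::field) \<Rightarrow> bool" where
  "heisenberg_triple f g h \<longleftrightarrow> (\<exists>Wf Rf Wg Rg Rh. writes f Wf \<and> reads f Rf \<and> writes g Wg \<and> reads g Rg \<and>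
     writes h Wf \<and> reads h Rh \<and> Wf \<inter> Rf = {} \<and> Wg \<inter> Rg = {} \<and> Wf \<inter> Rg = {} \<and>
     Rh \<inter> Wf = {} \<and> Rh \<inter> Wg = {} \<and> (\<forall>u i. f (shear g u) i = f u i + h u i))"

lemma heisenberg_tripleI:
  assumes "writes f Wf" "reads f Rf" "writes g Wg" "reads g Rg" "writes h Wf" "reads h Rh"
    "Wf \<inter> Rf = {}" "Wg \<inter> Rg = {}" "Wf \<inter> Rg = {}" "Rh \<inter> Wf = {}" "Rh \<inter> Wg = {}"
    "\<And>u i. f (shear g u) i = f u i + h u i"
  shows "heisenberg_triple f g h"
  unfolding heisenberg_triple_def by (intro exI[of _ Wf] exI[of _ Rf] exI[of _ Wg] exI[of _ Rg] exI[of _ Rh] conjI allI assms)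

lemma heisenberg_triple_relations:
  assumes "heisenberg_triple f g h"
  shows "reads_off_writes f" "reads_off_writes g" "reads_off_writes h"
    "shear f \<circ> shear g = shear h \<circ> (shear g \<circ> shear f)"
    "shear h \<circ> shear f = shear f \<circ> shear h" "shear h \<circ> shear g = shear g \<circ> shear h"
proof -
  obtain Wf Rf Wg Rg Rh where *: "writes f Wf" "reads f Rf" "writes g Wg" "reads g Rg" "writes h Wf"
     "reads h Rh" "Wf \<inter> Rf = {}" "Wg \<inter> Rg = {}" "Wf \<inter> Rg = {}" "Rh \<inter> Wf = {}" "Rh \<inter> Wg = {}"
     and fg: "\<And>u i. f (shear g u) i = f u i + h u i"
    using assms unfolding heisenberg_triple_def by blast
  show "reads_off_writes f" "reads_off_writes g" "reads_off_writes h" using * unfolding reads_off_writes_def by (blast, blast, metis Int_commute)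
  have hf: "h (shear f u) = h u" and hg: "h (shear g u) = h u" and gf: "g (shear f u) = g u"
    and fh: "f (shear h u) = f u" and gh: "g (shear h u) = g u" for u
    using * by (auto intro!: reads_shear simp: Int_commute)
  show "shear f \<circ> shear g = shear h \<circ> (shear g \<circ> shear f)"
  proof
    fix u
    have "h (shear g (shear f u)) = h u" by (simp add: hf hg)
    thus "(shear f \<circ> shear g) u = (shear h \<circ> (shear g \<circ> shear f)) u"
      by (simp add: shear_def[of f "shear g u"] shear_def[of h "shear g (shear f u)"] fg)
        (simp add: shear_def[of g] gf, simp add: shear_def[of f] fun_eq_iff)
  qed
  show "shear h \<circ> shear f = shear f \<circ> shear h"
    by (simp add: fun_eq_iff shear_def[of h "shear f _"] shear_def[of f "shear h _"] hf fh)
       (simp add: shear_def)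
  show "shear h \<circ> shear g = shear g \<circ> shear h"
    by (simp add: fun_eq_iff shear_def[of h "shear g _"] shear_def[of g "shear h _"] hg gh)
       (simp add: shear_def)
qed

lemma writes_single: "writes (single a \<phi>) {a}"
  by (simp add: writes_def single_def)

lemma reads_single: "reads \<phi> R \<Longrightarrow> reads (single a \<phi>) R"
  unfolding reads_def single_def by metis

lemma reads_coord: "reads (\<lambda>u. u b) {b}"
  by (simp add: reads_def)

lemma reads_const: "reads (\<lambda>u. c) {}"
  by (simp add: reads_def)

lemma reads_mult: "reads \<phi> R \<Longrightarrow> reads \<psi> S \<Longrightarrow> reads (\<lambda>u. \<phi> u * (\<psi> u :: 'k::field)) (R \<union> S)"
  unfolding reads_def by (metis UnI1 UnI2)

lemma writes_block: "writes (block N s j) {i. i mod 3 = j mod 3 \<and> i < N}"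
  by (simp add: writes_def block_def)

lemma reads_block: "reads (block N s j) {i. s \<le> i \<and> (i - s) mod 3 = j mod 3}"
  by (simp add: reads_def block_def fun_eq_iff)

lemma add_mod3_neq:
  assumes "s = 1 \<or> s = (2::nat)"
  shows "(k + s) mod 3 \<noteq> k mod 3"
proof -
  have "(k + 1) mod 3 \<noteq> k mod 3" "(k + 2) mod 3 \<noteq> k mod 3" by presburger+
  thus ?thesis using assms by auto
qed

lemma mod3_block:
  assumes "s = 1 \<or> s = (2::nat)"
  shows "{i. i mod 3 = j mod 3 \<and> i < N} \<inter> {i. s \<le> i \<and> (i - s) mod 3 = j mod 3} = {}"
proof -
  have False if "i mod 3 = j mod 3" "s \<le> i" "(i - s) mod 3 = j mod 3" for i
    using add_mod3_neq[OF assms, of "i - s"] that by simp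
  thus ?thesis by blast
qed

lemma heisenberg_triple_commute:
  assumes "writes f Wf" "reads f Rf" "writes g Wg" "reads g Rg"
    "Wf \<inter> Rf = {}" "Wg \<inter> Rg = {}" "Wf \<inter> Rg = {}" "Wg \<inter> Rf = {}"
  shows "heisenberg_triple f g (\<lambda>u i. 0)"
  by (rule heisenberg_tripleI[OF assms(1-4), of _ "{}"])
     (use assms reads_shear(2)[OF assms(2,3)] in \<open>auto simp: writes_def reads_def\<close>)

text \<open>
  Substituting \<open>u b + \<psi> u\<close> for \<open>u b\<close> in \<open>\<phi>\<close>: this is how products of coordinates arise.
\<close>

lemma heisenberg_triple_single:
  assumes "a \<noteq> b" "reads \<phi> R" "a \<notin> R" "reads \<psi> S" "a \<notin> S" "b \<notin> S" "reads \<chi> T" "a \<notin> T" "b \<notin> T"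
    and "\<And>u. \<phi> (u(b := u b + \<psi> u)) = \<phi> u + \<chi> u"
  shows "heisenberg_triple (single a \<phi>) (single b \<psi>) (single a \<chi>)"
proof (rule heisenberg_tripleI[of _ "{a}" R _ "{b}" S _ T])
  have "shear (single b \<psi>) u = u(b := u b + \<psi> u)" for u
    by (simp add: shear_def single_def fun_eq_iff)
  thus "single a \<phi> (shear (single b \<psi>) u) i = single a \<phi> u i + single a \<chi> u i" for u i
    using assms(10)[of u] by (simp add: single_def)
qed (use assms in \<open>auto intro: writes_single reads_single\<close>)

lemma heisenberg_triple_block_block:
  assumes "k mod 3 = (j + 1) mod 3"
  shows "heisenberg_triple (block N 1 j) (block N 1 k) (block N 2 j)"
proof (rule heisenberg_tripleI[OF writes_block reads_block writes_block reads_block writes_block reads_block])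
  show "block N 1 j (shear (block N 1 k) u) i = block N 1 j u i + block N 2 j u i" for u i
  proof (cases "i mod 3 = j mod 3")
    case True
    hence "Suc i mod 3 = k mod 3" using assms by (metis Suc_eq_plus1 mod_add_left_eq)
    thus ?thesis using True by (auto simp: block_def shear_def)
  qed (simp add: block_def)
  have k: "k mod 3 \<noteq> j mod 3" using assms add_mod3_neq[of 1 j] by simp
  have k2: "(j + 2) mod 3 \<noteq> k mod 3" using assms add_mod3_neq[of 1 "j + 1"] by simp
  have shift: "i mod 3 = (j + s) mod 3" if "s \<le> i" "(i - s) mod 3 = j mod 3" for i j s :: nat
    using that by (metis le_add_diff_inverse2 mod_add_left_eq)
  show "{i. i mod 3 = j mod 3 \<and> i < N} \<inter> {i. 1 \<le> i \<and> (i - 1) mod 3 = k mod 3} = {}"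
  proof -
    have False if "i mod 3 = j mod 3" "1 \<le> i" "(i - 1) mod 3 = k mod 3" for i
    proof -
      have "(k + 1) mod 3 = (j + 2) mod 3" using assms by (metis add.assoc mod_add_left_eq one_add_one)
      thus False using shift[OF that(2,3)] that(1) add_mod3_neq[of 2 j] by simp
    qed
    thus ?thesis by blast
  qed
  show "{i. 2 \<le> i \<and> (i - 2) mod 3 = j mod 3} \<inter> {i. i mod 3 = k mod 3 \<and> i < N} = {}"
  proof -
    have False if "2 \<le> i" "(i - 2) mod 3 = j mod 3" "i mod 3 = k mod 3" for i
      using shift[OF that(1,2)] that(3) k2 by simp
    thus ?thesis by blast
  qed
  show "{i. 2 \<le> i \<and> (i - 2) mod 3 = j mod 3} \<inter> {i. i mod 3 = j mod 3 \<and> i < N} = {}"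
    using mod3_block[of 2 j N] by blast
qed (rule mod3_block, simp)+

text \<open>
  Composing a block with the shear of a single coordinate \<open>a\<close> moves the written coordinate \<open>s\<close> places to
  the left. Although a block is a global object, only one of its coordinates reads \<open>a\<close>.
\<close>

lemma heisenberg_triple_block_single:
  assumes s: "s = 1 \<or> s = 2" and a: "s \<le> a" "a < N" and \<psi>: "reads \<psi> S" "a \<notin> S"
    and S: "\<And>i. i \<in> S \<Longrightarrow> i mod 3 \<noteq> (a - s) mod 3"
  shows "heisenberg_triple (block N s (a - s)) (single a \<psi>) (single (a - s) \<psi>)"
proof (rule heisenberg_tripleI[OF writes_block reads_block writes_single reads_single[OF \<psi>(1)] _ reads_single[OF \<psi>(1)]])
  show "writes (single (a - s) \<psi>) {i. i mod 3 = (a - s) mod 3 \<and> i < N}"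
    by (rule writes_mono[OF writes_single]) (use a in auto)
  show "block N s (a - s) (shear (single a \<psi>) u) i = block N s (a - s) u i + single (a - s) \<psi> u i" for u i
    using a by (auto simp: block_def shear_def single_def)
qed (use s a S \<psi> mod3_block in \<open>auto\<close>)

text \<open>
  Dually, the coordinate that is read moves \<open>s\<close> places to the right.
\<close>

lemma heisenberg_triple_single_block:
  assumes s: "s = 1 \<or> s = 2" and b: "b + s < N" and ab: "a \<noteq> b" "a mod 3 \<noteq> (b + s) mod 3"
  shows "heisenberg_triple (single a (\<lambda>u. u b)) (block N s b) (single a (\<lambda>u. u (b + s)))"
proof (rule heisenberg_tripleI[OF writes_single reads_single[OF reads_coord] writes_block reads_block writes_single
    reads_single[OF reads_coord]])
  show "{a} \<inter> {i. s \<le> i \<and> (i - s) mod 3 = b mod 3} = {}"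
  proof -
    have "a mod 3 = (b + s) mod 3" if "s \<le> a" "(a - s) mod 3 = b mod 3"
      using that by (metis le_add_diff_inverse2 mod_add_left_eq)
    thus ?thesis using ab by auto
  qed
  show "{b + s} \<inter> {i. i mod 3 = b mod 3 \<and> i < N} = {}" using add_mod3_neq[OF s] by auto
  show "single a (\<lambda>u. u b) (shear (block N s b) u) i
      = single a (\<lambda>u. u b) u i + single a (\<lambda>u. u (b + s)) u i" for u i
    using b by (auto simp: block_def shear_def single_def)
qed (use s ab mod3_block in auto)

section \<open>The six generators\<close>

text \<open>
  The first three generators are global linear maps, whose commutators with the other ones propagate these
  along the line of coordinates. The fourth closes the line of coordinates to a circle, the fifth is the only
  nonlinear one and the sixth is a translation. Blocks do not wrap around: otherwise the fifth generator
  and the third block would each read a coordinate that the other one writes.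
\<close>

definition generator :: "nat \<Rightarrow> nat \<Rightarrow> (nat \<Rightarrow> 'k::field) \<Rightarrow> nat \<Rightarrow> 'k" where
  "generator N i = (if i < 3 then block N 1 i
    else if i = 3 then single (N - 1) (\<lambda>u. u 0)
    else if i = 4 then single 0 (\<lambda>u. u 1 * u 2)
    else single 2 (\<lambda>u. 1))"

lemma heisenberg_triple_writes: "heisenberg_triple f g h \<Longrightarrow> writes f W \<Longrightarrow> writes h W"
  unfolding heisenberg_triple_def writes_def by (metis add_0)

lemma last_mod3:
  assumes N: "N mod 3 = (0::nat)" "9 \<le> N"
  shows "(N - 1) mod 3 = 2" "(N - 2) mod 3 = 1"
proof -
  define k where "k = N div 3 - 1"
  have "N - 1 = 2 + 3 * k" "N - 2 = 1 + 3 * k" using N unfolding k_def by auto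
  thus "(N - 1) mod 3 = 2" "(N - 2) mod 3 = 1" by (simp_all only: mod_mult_self2) simp_all
qed

lemma writes_generator:
  assumes "3 \<le> N"
  shows "writes (generator N i :: (nat \<Rightarrow> 'k::field) \<Rightarrow> nat \<Rightarrow> 'k) {..<N}"
proof -
  have "writes (block N 1 i :: (nat \<Rightarrow> 'k) \<Rightarrow> nat \<Rightarrow> 'k) {..<N}" by (rule writes_mono[OF writes_block]) auto
  moreover have "writes (single a \<phi>) {..<N}" if "a < N" for a and \<phi> :: "(nat \<Rightarrow> 'k) \<Rightarrow> 'k"
    by (rule writes_mono[OF writes_single]) (use that in auto)
  ultimately show ?thesis using assms unfolding generator_def by simp
qed

text \<open>
  For each pair, one of the two generators does not read what the other one writes, and the one that
  reads depends on the written coordinates in an affine way.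
\<close>

lemma heisenberg_triple_generators:
  assumes N: "N mod 3 = 0" "9 \<le> N" and ij: "i < j" "j < 6"
  shows "\<exists>h. heisenberg_triple (generator N i) (generator N j) h \<or> heisenberg_triple (generator N j) (generator N i :: (nat \<Rightarrow> 'k::field) \<Rightarrow> nat \<Rightarrow> 'k) h"
proof -
  let ?g = "generator N :: nat \<Rightarrow> (nat \<Rightarrow> 'k) \<Rightarrow> nat \<Rightarrow> 'k"
  have last: "(N - 1) mod 3 = 2" "(N - 2) mod 3 = 1"
    using last_mod3[OF N] by simp_all
  have g: "?g 0 = block N 1 0" "?g 1 = block N 1 1" "?g 2 = block N 1 2"
    "?g 3 = single (N - 1) (\<lambda>u. u 0)" "?g 4 = single 0 (\<lambda>u. u 1 * u 2)" "?g 5 = single 2 (\<lambda>u. 1)"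
    by (simp_all add: generator_def)
  have rQ: "reads (\<lambda>u. u 1 * (u 2 :: 'k)) {1, 2}"
    using reads_mult[OF reads_coord[of 1] reads_coord[of 2]] by (simp add: insert_commute)
  note rs = reads_single[OF reads_coord] reads_single[OF reads_const] reads_single[OF rQ]
  have h01: "heisenberg_triple (?g 0) (?g 1) (block N 2 0)" unfolding g by (rule heisenberg_triple_block_block) simp
  have h12: "heisenberg_triple (?g 1) (?g 2) (block N 2 1)" unfolding g by (rule heisenberg_triple_block_block) simp
  have h20: "heisenberg_triple (?g 2) (?g 0) (block N 2 2)" unfolding g by (rule heisenberg_triple_block_block) simp
  have h30: "heisenberg_triple (?g 3) (?g 0) (single (N - 1) (\<lambda>u. u (0 + 1)))" unfolding g
    by (rule heisenberg_triple_single_block) (use N last in auto)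
  have h13: "heisenberg_triple (?g 1) (?g 3) (single (N - 1 - 1) (\<lambda>u. u 0))"
  proof -
    have "(block N 1 (N - 1 - 1) :: (nat \<Rightarrow> 'k) \<Rightarrow> nat \<Rightarrow> 'k) = block N 1 1"
      using last by (simp add: block_def fun_eq_iff numeral_2_eq_2)
    moreover have "heisenberg_triple (block N 1 (N - 1 - 1) :: (nat \<Rightarrow> 'k) \<Rightarrow> nat \<Rightarrow> 'k)
        (single (N - 1) (\<lambda>u. u 0)) (single (N - 1 - 1) (\<lambda>u. u 0))"
      by (rule heisenberg_triple_block_single[OF _ _ _ reads_coord]) (use N last in \<open>auto simp: numeral_2_eq_2\<close>)
    ultimately show ?thesis unfolding g by simp
  qed
  have h23: "heisenberg_triple (?g 2) (?g 3) (\<lambda>u i. 0)" unfolding g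
    by (rule heisenberg_triple_commute[OF writes_block reads_block writes_single rs(1) mod3_block])
       (use N last in \<open>auto simp: numeral_2_eq_2\<close>)
  have h34: "heisenberg_triple (?g 3) (?g 4) (single (N - 1) (\<lambda>u. u 1 * u 2))" unfolding g
    by (rule heisenberg_triple_single[OF _ reads_coord _ rQ _ _ rQ]) (use N in auto)
  have h04: "heisenberg_triple (?g 0) (?g 4) (\<lambda>u i. 0)" unfolding g
    by (rule heisenberg_triple_commute[OF writes_block reads_block writes_single rs(3) mod3_block]) (use N in auto)
  have h41: "heisenberg_triple (?g 4) (?g 1) (single 0 (\<lambda>u. u 2 * u 2))" unfolding g
  proof (rule heisenberg_tripleI[OF writes_single rs(3) writes_block reads_block writes_single reads_single])
    show "reads (\<lambda>u. u 2 * (u 2 :: 'k)) {2}" by (simp add: reads_def)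
    show "single 0 (\<lambda>u. u 1 * u 2) (shear (block N 1 1) u) i
        = single 0 (\<lambda>u. u 1 * u 2) u i + single 0 (\<lambda>u. u 2 * u 2) u i" for i and u :: "nat \<Rightarrow> 'k"
      using N by (simp add: single_def shear_def block_def distrib_right numeral_2_eq_2)
    show "{i. i mod 3 = 1 mod 3 \<and> i < N} \<inter> {i. 1 \<le> i \<and> (i - 1) mod 3 = 1 mod 3} = {}"
      by (rule mod3_block) simp
  qed auto
  have h42: "heisenberg_triple (?g 4) (?g 2) (single 0 (\<lambda>u. u 1 * u 3))" unfolding g
  proof (rule heisenberg_tripleI[OF writes_single rs(3) writes_block reads_block writes_single reads_single])
    show "reads (\<lambda>u. u 1 * (u 3 :: 'k)) {1, 3}" by (simp add: reads_def)
    show "single 0 (\<lambda>u. u 1 * u 2) (shear (block N 1 2) u) i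
        = single 0 (\<lambda>u. u 1 * u 2) u i + single 0 (\<lambda>u. u 1 * u 3) u i" for i and u :: "nat \<Rightarrow> 'k"
      using N by (simp add: single_def shear_def block_def distrib_left)
    show "{i. i mod 3 = 2 mod 3 \<and> i < N} \<inter> {i. 1 \<le> i \<and> (i - 1) mod 3 = 2 mod 3} = {}"
      by (rule mod3_block) simp
  qed auto
  have h05: "heisenberg_triple (?g 0) (?g 5) (\<lambda>u i. 0)" unfolding g
    by (rule heisenberg_triple_commute[OF writes_block reads_block writes_single rs(2) mod3_block]) auto
  have h15: "heisenberg_triple (?g 1) (?g 5) (single (2 - 1) (\<lambda>u. 1))"
  proof -
    have "heisenberg_triple (block N 1 (2 - 1) :: (nat \<Rightarrow> 'k) \<Rightarrow> nat \<Rightarrow> 'k) (single 2 (\<lambda>u. 1)) (single (2 - 1) (\<lambda>u. 1))"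
      by (rule heisenberg_triple_block_single[OF _ _ _ reads_const]) (use N in auto)
    thus ?thesis unfolding g by simp
  qed
  have h25: "heisenberg_triple (?g 2) (?g 5) (\<lambda>u i. 0)" unfolding g
    by (rule heisenberg_triple_commute[OF writes_block reads_block writes_single rs(2) mod3_block]) auto
  have h35: "heisenberg_triple (?g 3) (?g 5) (\<lambda>u i. 0)" unfolding g
    by (rule heisenberg_triple_commute[OF writes_single rs(1) writes_single rs(2)]) (use N in auto)
  have h45: "heisenberg_triple (?g 4) (?g 5) (single 0 (\<lambda>u. u 1))" unfolding g
    by (rule heisenberg_triple_single[OF _ rQ _ reads_const _ _ reads_coord]) (auto simp: algebra_simps)
  define P where "P i j = (\<exists>h. heisenberg_triple (?g i) (?g j) h \<or> heisenberg_triple (?g j) (?g i) h)" for i j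
  have P0: "P 0 1" using h01 unfolding P_def by blast
  have P1: "P 0 2" using h20 unfolding P_def by blast
  have P2: "P 0 3" using h30 unfolding P_def by blast
  have P3: "P 0 4" using h04 unfolding P_def by blast
  have P4: "P 0 5" using h05 unfolding P_def by blast
  have P5: "P 1 2" using h12 unfolding P_def by blast
  have P6: "P 1 3" using h13 unfolding P_def by blast
  have P7: "P 1 4" using h41 unfolding P_def by blast
  have P8: "P 1 5" using h15 unfolding P_def by blast
  have P9: "P 2 3" using h23 unfolding P_def by blast
  have P10: "P 2 4" using h42 unfolding P_def by blast
  have P11: "P 2 5" using h25 unfolding P_def by blast
  have P12: "P 3 4" using h34 unfolding P_def by blast
  have P13: "P 3 5" using h35 unfolding P_def by blast
  have P14: "P 4 5" using h45 unfolding P_def by blast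
  note P = P0 P1 P2 P3 P4 P5 P6 P7 P8 P9 P10 P11 P12 P13 P14
  have "i = 0 \<and> (j = 1 \<or> j = 2 \<or> j = 3 \<or> j = 4 \<or> j = 5) \<or> i = 1 \<and> (j = 2 \<or> j = 3 \<or> j = 4 \<or> j = 5)
    \<or> i = 2 \<and> (j = 3 \<or> j = 4 \<or> j = 5) \<or> i = 3 \<and> (j = 4 \<or> j = 5) \<or> i = 4 \<and> j = 5"
    using ij by arith
  hence "P i j" using P by (elim disjE conjE) (simp_all only:)
  thus ?thesis by (simp add: P_def)
qed

lemma reads_off_writes_generator:
  assumes N: "N mod 3 = 0" "9 \<le> N" and i: "i < 6"
  shows "reads_off_writes (generator N i)"
proof (cases "i < 5")
  case True thus ?thesis using heisenberg_triple_generators[OF N True] heisenberg_triple_relations(1,2) by auto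
next
  case False
  hence "i = 5" using i by simp
  thus ?thesis using heisenberg_triple_generators[OF N, of 4 5] heisenberg_triple_relations(1,2) by auto
qed

section \<open>Generating shears by indicator functions\<close>

text \<open>
  \<open>M\<close> stands for the set of maps that induce elements of the group generated by the six generators. Closure
  under scalars replaces closure under inverses, and will come from the finite order of shears over a
  prime field.
\<close>

locale shear_moves =
  fixes N :: nat and M :: "((nat \<Rightarrow> 'k::{field,finite}) \<Rightarrow> nat \<Rightarrow> 'k) set"
  assumes N: "N mod 3 = 0" "9 \<le> N"
    and comp_mem_M: "\<And>g h. g \<in> M \<Longrightarrow> h \<in> M \<Longrightarrow> g \<circ> h \<in> M"
    and scale_mem_M: "\<And>f c. reads_off_writes f \<Longrightarrow> shear f \<in> M \<Longrightarrow> shear (\<lambda>u i. c * f u i) \<in> M"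
    and generator_mem_M: "\<And>i. i < 6 \<Longrightarrow> shear (generator N i) \<in> M"
begin

lemma heisenberg_triple_mem_M:
  assumes "heisenberg_triple f g h" "shear f \<in> M" "shear g \<in> M"
  shows "shear h \<in> M"
proof -
  define f' where "f' = shear (\<lambda>u i. -1 * f u i)"
  define g' where "g' = shear (\<lambda>u i. -1 * g u i)"
  note r = heisenberg_triple_relations[OF assms(1)]
  have "f' \<in> M" "g' \<in> M" unfolding f'_def g'_def using r(1,2) assms by (blast intro: scale_mem_M)+
  hence "(shear f \<circ> shear g) \<circ> (f' \<circ> g') \<in> M" using assms by (intro comp_mem_M)
  moreover have ff: "shear f (f' u) = u" for u
    using shear_scale_compose[OF r(1), of 1 "-1" u] by (simp add: f'_def shear_zero[unfolded id_def])
       (simp add: shear_def)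
  moreover have gg: "shear g (g' u) = u" for u
    using shear_scale_compose[OF r(2), of 1 "-1" u] by (simp add: g'_def) (simp add: shear_def)
  ultimately show ?thesis unfolding r(4) by (simp add: comp_def ff gg)
qed

text \<open>
  From here on shears of a single coordinate are considered. They are produced in the order: all
  coordinates, all products of two coordinates, and then, for each choice of three excluded
  coordinates, an algebra of functions of the other ones.
\<close>

definition has_shear :: "nat \<Rightarrow> ((nat \<Rightarrow> 'k) \<Rightarrow> 'k) \<Rightarrow> bool" where
  "has_shear a \<phi> \<longleftrightarrow> shear (single a \<phi>) \<in> M"

lemma reads_off_writes_single: "reads \<phi> R \<Longrightarrow> a \<notin> R \<Longrightarrow> reads_off_writes (single a \<phi>)"
  unfolding reads_off_writes_def using writes_single reads_single by (metis Int_insert_left_if0 Int_empty_left)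

lemma has_shear_scale:
  assumes "reads \<phi> R" "a \<notin> R" "has_shear a \<phi>"
  shows "has_shear a (\<lambda>u. c * \<phi> u)"
proof -
  have "(\<lambda>u i. c * single a \<phi> u i) = single a (\<lambda>u. c * \<phi> u)"
    by (simp add: single_def fun_eq_iff)
  thus ?thesis using scale_mem_M[OF reads_off_writes_single[OF assms(1,2)], of c] assms(3) by (simp add: has_shear_def)
qed

lemma has_shear_add:
  assumes "reads \<phi> R" "a \<notin> R" "has_shear a \<phi>" "has_shear a \<psi>"
  shows "has_shear a (\<lambda>u. \<phi> u + \<psi> u)"
proof -
  have "\<phi> (shear (single a \<psi>) u) = \<phi> u" for u
    by (rule reads_shear(2)[OF assms(1) writes_single]) (use assms(2) in auto)
  hence "shear (single a \<phi>) \<circ> shear (single a \<psi>) = shear (single a (\<lambda>u. \<phi> u + \<psi> u))"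
    by (auto simp: fun_eq_iff shear_def[of "single a \<phi>"] single_def[of a \<phi>])
       (auto simp: shear_def single_def)
  thus ?thesis using comp_mem_M[OF assms(3,4)[unfolded has_shear_def]] unfolding has_shear_def by simp
qed

lemma has_shear_commutator:
  assumes "a \<noteq> b" "reads \<phi> R" "a \<notin> R" "reads \<psi> S" "a \<notin> S" "b \<notin> S" "reads \<chi> T" "a \<notin> T" "b \<notin> T"
    and "\<And>u. \<phi> (u(b := u b + \<psi> u)) = \<phi> u + \<chi> u" "has_shear a \<phi>" "has_shear b \<psi>"
  shows "has_shear a \<chi>"
proof -
  have "heisenberg_triple (single a \<phi>) (single b \<psi>) (single a \<chi>)"
    by (rule heisenberg_triple_single[of a b \<phi> R \<psi> S \<chi> T]) (use assms in simp_all)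
  thus ?thesis using heisenberg_triple_mem_M assms(11,12) unfolding has_shear_def by blast
qed

lemma block_mem_M:
  assumes "s = 1 \<or> s = 2"
  shows "shear (block N s j) \<in> M"
proof -
  have mod: "block N s j = block N s (j mod 3)" for s j by (simp add: block_def fun_eq_iff)
  have 1: "shear (block N 1 j) \<in> M" for j
    using generator_mem_M[of "j mod 3"] by (subst mod) (simp add: generator_def)
  have "shear (block N 2 j) \<in> M"
    by (rule heisenberg_triple_mem_M[OF heisenberg_triple_block_block[of "j + 1" j N] 1 1]) simp
  thus ?thesis using 1 assms by auto
qed

lemma has_shear_right:
  assumes "s = 1 \<or> s = 2" "b + s < N" "a \<noteq> b" "a mod 3 \<noteq> (b + s) mod 3" "has_shear a (\<lambda>u. u b)"
  shows "has_shear a (\<lambda>u. u (b + s))"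
  using heisenberg_triple_mem_M[OF heisenberg_triple_single_block[OF assms(1-4)]] assms(5) block_mem_M[OF assms(1)] by (simp add: has_shear_def)

lemma has_shear_left:
  assumes "s = 1 \<or> s = 2" "a + s < N" "a mod 3 \<noteq> b mod 3" "a + s \<noteq> b" "has_shear (a + s) (\<lambda>u. u b)"
  shows "has_shear a (\<lambda>u. u b)"
proof -
  have "heisenberg_triple (block N s (a + s - s)) (single (a + s) (\<lambda>u. u b)) (single (a + s - s) (\<lambda>u. u b))"
    by (rule heisenberg_triple_block_single[OF assms(1) _ assms(2) reads_coord]) (use assms in auto)
  from heisenberg_triple_mem_M[OF this] show ?thesis using block_mem_M[OF assms(1)] assms(5) by (simp add: has_shear_def)
qed

lemma N_last: "(N - 1) mod 3 = 2"
  using last_mod3[OF N] by simp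

text \<open>
  The generator that closes the circle lets the last coordinate read coordinate 0. Moves to the right
  extend this; a move of two places jumps over the class of the last coordinate, where a block would
  interfere with it.
\<close>

lemma has_shear_last_coord:
  "b < N \<Longrightarrow> b mod 3 \<noteq> 2 \<Longrightarrow> has_shear (N - 1) (\<lambda>u. u b)"
proof (induction b rule: less_induct)
  case (less b)
  consider "b = 0" | "b mod 3 = 1" | "b \<noteq> 0" "b mod 3 = 0" using less.prems(2) by linarith
  thus ?case
  proof cases
    case 1 thus ?thesis using generator_mem_M[of 3] by (simp add: generator_def has_shear_def)
  next
    case 2
    then obtain c where c: "b = c + 1" by (cases b) auto
    have "c mod 3 = 0" using 2 c by presburger
    hence "has_shear (N - 1) (\<lambda>u. u c)" using less c by auto
    thus ?thesis using has_shear_right[of 1 c "N - 1"] c less.prems N_last 2 by auto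
  next
    case 3
    hence "b \<ge> 2" by (cases "b = 1") auto
    then obtain c where c: "b = c + 2" by (metis le_add_diff_inverse2)
    have "c mod 3 = 1" using 3 c by presburger
    hence "has_shear (N - 1) (\<lambda>u. u c)" using less c by auto
    moreover have "N - 1 \<noteq> c" using c less.prems by auto
    ultimately show ?thesis using has_shear_right[of 2 c "N - 1"] c less.prems N_last 3 by auto
  qed
qed

text \<open>
  Moves to the left, starting from the last coordinate; a move of two places jumps over the class of \<open>b\<close>.
\<close>

lemma has_shear_coord_other_class:
  assumes b: "b < N" "b mod 3 \<noteq> 2"
  shows "a + d = N - 1 \<Longrightarrow> a mod 3 \<noteq> b mod 3 \<Longrightarrow> has_shear a (\<lambda>u. u b)"
proof (induction d arbitrary: a rule: less_induct)
  case (less d)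
  show ?case
  proof (cases "d = 0")
    case True thus ?thesis using has_shear_last_coord[OF b] less.prems by simp
  next
    case d: False
    show ?thesis
    proof (cases "(a + 1) mod 3 = b mod 3")
      case False
      have "has_shear (a + 1) (\<lambda>u. u b)" using less.IH[of "d - 1" "a + 1"] less.prems d False by simp
      thus ?thesis using has_shear_left[of 1 a b] less.prems d False by force
    next
      case True
      have "a + 1 \<noteq> N - 1" using True N_last b by auto
      hence d2: "d \<ge> 2" using less.prems d by (cases "d = 1") auto
      have ne: "(a + 2) mod 3 \<noteq> b mod 3" using True add_mod3_neq[of 1 "a + 1"] by simp
      have "has_shear (a + 2) (\<lambda>u. u b)" using less.IH[of "d - 2" "a + 2"] less.prems d2 ne by simp
      thus ?thesis using has_shear_left[of 2 a b] less.prems d2 ne by force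
    qed
  qed
qed

lemma has_shear_coord:
  assumes "a < N" "b < N" "a \<noteq> b"
  shows "has_shear a (\<lambda>u. u b)"
proof -
  have start: "has_shear a (\<lambda>u. u b)" if "a < N" "b < N" "b mod 3 \<noteq> 2" "a mod 3 \<noteq> b mod 3" for a b
    using has_shear_coord_other_class[OF that(2,3), of a "N - 1 - a"] that by simp
  have 2: "has_shear a (\<lambda>u. u b)" if ab: "a < N" "b < N" "a mod 3 \<noteq> b mod 3" for a b
  proof (cases "b mod 3 = 2")
    case True
    then obtain c where c: "b = c + 2" by (metis le_add_diff_inverse2 mod_less_eq_dividend)
    have c0: "c mod 3 = 0" using True c by presburger
    consider "a mod 3 = 0" | "a mod 3 = 1" using True ab(3) by linarith
    thus ?thesis
    proof cases
      case 1
      have "(c + 1) mod 3 = 1" using c0 by presburger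
      hence "has_shear a (\<lambda>u. u (c + 1))" using \<open>a mod 3 = 0\<close> ab c start[of a "c + 1"] by simp
      moreover have "a \<noteq> c + 1" using \<open>(c + 1) mod 3 = 1\<close> \<open>a mod 3 = 0\<close> by auto
      ultimately show ?thesis using has_shear_right[of 1 "c + 1" a] c ab True by auto
    next
      case 2
      hence "has_shear a (\<lambda>u. u c)" using c0 ab c start[of a c] by simp
      moreover have "a \<noteq> c" using 2 c0 by auto
      ultimately show ?thesis using has_shear_right[of 2 c a] c ab True by auto
    qed
  qed (use start ab in auto)
  show ?thesis
  proof (cases "a mod 3 = b mod 3")
    case True
    define c where "c = (if b mod 3 = 0 then 1 else 0 :: nat)"
    have c: "c < N" "c mod 3 \<noteq> b mod 3" using N by (auto simp: c_def)
    hence ne: "a \<noteq> c" "c \<noteq> b" using True by auto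
    show ?thesis
      by (rule has_shear_commutator[OF ne(1) reads_coord _ reads_coord _ _ reads_coord _ _ _ 2 2])
         (use c ne True assms in auto)
  qed (use 2 assms in auto)
qed

lemma has_shear_transfer:
  assumes "has_shear a \<phi>" "reads \<phi> R" "a \<notin> R" "c \<notin> R" "a < N" "c < N"
  shows "has_shear c \<phi>"
proof (cases "a = c")
  case False
  show ?thesis
    by (rule has_shear_commutator[OF _ reads_coord _ assms(2) _ _ assms(2) _ _ _ has_shear_coord assms(1)])
       (use False assms in auto)
qed (use assms in simp)

lemma reads_coord_mult: "reads (\<lambda>u. u b * u c :: 'k) {b, c}"
  using reads_mult[OF reads_coord[of b] reads_coord[of c]] by (simp add: insert_commute)

lemma has_shear_coord_mult_change:
  assumes "distinct [a, b, c]" "distinct [a, d, c]" "a < N" "b < N" "c < N" "d < N" "has_shear a (\<lambda>u. u b * u c)"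
  shows "has_shear a (\<lambda>u. u d * u c)"
proof (cases "b = d")
  case False
  show ?thesis
    by (rule has_shear_commutator[OF _ reads_coord_mult _ reads_coord _ _ reads_coord_mult _ _ _ assms(7) has_shear_coord])
       (use False assms in \<open>auto simp: algebra_simps\<close>)
qed (use assms in simp)

text \<open>
  The three indices are replaced one after the other. Passing through fresh indices \<open>d\<close>, \<open>e\<close>, \<open>f\<close> avoids
  products with repeated factors; this is why at least nine coordinates are assumed.
\<close>

lemma has_shear_coord_mult:
  assumes abc: "distinct [a, b, c]" "a < N" "b < N" "c < N"
  shows "has_shear a (\<lambda>u. u b * u c)"
proof -
  have "3 \<le> card ({..<9} - {0, 1, 2, a, b, c} :: nat set)"
  proof -
    have "card (set [0, 1, 2, a, b, c]) \<le> length [0, 1, 2, a, b, c]" by (rule card_length)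
    hence "card {0, 1, 2, a, b, c} \<le> 6" by (simp only: list.set) simp
    moreover have "card {..<9::nat} - card {0, 1, 2, a, b, c} \<le> card ({..<9} - {0, 1, 2, a, b, c})"
      by (rule diff_card_le_card_Diff) simp
    ultimately show ?thesis unfolding card_lessThan by linarith
  qed
  then obtain F where F: "F \<subseteq> {..<9} - {0, 1, 2, a, b, c}" "card F = 3"
    by (meson obtain_subset_with_card_n)
  then obtain d e f where def: "F = {d, e, f}" "distinct [d, e, f]"
    by (auto simp: card_3_iff)
  have d: "d < N" "e < N" "f < N" "0 < N" "1 < N" "2 < N" using F(1) def(1) N by auto
  have ne: "d \<notin> {0, 1, 2, a, b, c}" "e \<notin> {0, 1, 2, a, b, c}" "f \<notin> {0, 1, 2, a, b, c}"
    using F(1) def(1) by auto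
  have swap: "has_shear x (\<lambda>u. u y * u z) \<Longrightarrow> has_shear x (\<lambda>u. u z * u y)" for x y z
    by (simp add: mult.commute)
  have de: "d \<noteq> e" "d \<noteq> f" "e \<noteq> f" using def(2) by auto
  have "has_shear 0 (\<lambda>u. u 1 * u 2)" using generator_mem_M[of 4] by (simp add: generator_def has_shear_def)
  hence "has_shear 0 (\<lambda>u. u d * u 2)" using has_shear_coord_mult_change[of 0 1 2 d] d ne by simp
  hence "has_shear 0 (\<lambda>u. u e * u d)" using has_shear_coord_mult_change[of 0 2 d e] swap[of 0 d 2] d ne de by simp
  hence "has_shear f (\<lambda>u. u e * u d)"
    using has_shear_transfer[OF _ reads_coord_mult[of e d], of 0 f] d ne de by simp
  hence "has_shear f (\<lambda>u. u b * u d)" using has_shear_coord_mult_change[of f e d b] d ne de abc by auto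
  hence "has_shear f (\<lambda>u. u c * u b)" using has_shear_coord_mult_change[of f d b c] swap[of f b d] d ne de abc by auto
  hence "has_shear a (\<lambda>u. u c * u b)"
    using has_shear_transfer[OF _ reads_coord_mult[of c b], of f a] d ne de abc by simp
  thus ?thesis by (rule swap)
qed

text \<open>
  Coordinates \<open>b\<close> and \<open>c\<close> serve as registers: in the quadratic shear \<open>u b * u c\<close> of coordinate \<open>a\<close>, substitution
  replaces the first factor by \<open>\<phi>\<close> and the second by \<open>\<psi>\<close>. Therefore neither function may read a register.
\<close>

lemma has_shear_mult:
  assumes abc: "distinct [a, b, c]" "a < N" "b < N" "c < N"
    and \<phi>: "reads \<phi> (- {a, b, c})" "has_shear a \<phi>" and \<psi>: "reads \<psi> (- {a, b, c})" "has_shear a \<psi>"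
  shows "has_shear a (\<lambda>u. \<phi> u * \<psi> u)"
proof -
  have b: "has_shear b \<phi>" by (rule has_shear_transfer[OF \<phi>(2,1)]) (use abc in auto)
  have c: "has_shear c \<psi>" by (rule has_shear_transfer[OF \<psi>(2,1)]) (use abc in auto)
  have r: "reads (\<lambda>u. \<phi> u * u c) (- {a, b, c} \<union> {c})" by (rule reads_mult[OF \<phi>(1) reads_coord])
  have 1: "has_shear a (\<lambda>u. \<phi> u * u c)"
    by (rule has_shear_commutator[OF _ reads_coord_mult _ \<phi>(1) _ _ r _ _ _ has_shear_coord_mult[OF abc] b])
       (use abc in \<open>auto simp: algebra_simps\<close>)
  have r2: "reads (\<lambda>u. \<phi> u * \<psi> u) (- {a, b, c} \<union> - {a, b, c})" by (rule reads_mult[OF \<phi>(1) \<psi>(1)])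
  have "\<phi> (u(c := x)) = \<phi> u" for u x by (rule readsD[OF \<phi>(1)]) auto
  thus ?thesis
    by (intro has_shear_commutator[OF _ r _ \<psi>(1) _ _ r2 _ _ _ 1 c]) (use abc in \<open>auto simp: algebra_simps\<close>)
qed

lemma has_shear_const: "a < N \<Longrightarrow> has_shear a (\<lambda>u. c)"
proof -
  assume a: "a < N"
  have "has_shear 2 (\<lambda>u. 1)" using generator_mem_M[of 5] by (simp add: generator_def has_shear_def)
  hence "has_shear a (\<lambda>u. 1)" by (rule has_shear_transfer[OF _ reads_const]) (use a N in auto)
  hence "has_shear a (\<lambda>u. c * 1)" by (intro has_shear_scale[OF reads_const]) auto
  thus ?thesis by simp
qed

lemma has_shear_prod:
  assumes abc: "distinct [a, b, c]" "a < N" "b < N" "c < N"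
    and I: "finite I" "\<And>i. i \<in> I \<Longrightarrow> has_shear a (F i)" "\<And>i. i \<in> I \<Longrightarrow> reads (F i) (- {a, b, c})"
  shows "has_shear a (\<lambda>u. \<Prod>i\<in>I. F i u) \<and> reads (\<lambda>u. \<Prod>i\<in>I. F i u) (- {a, b, c})"
  using I
proof (induction I rule: finite_induct)
  case empty
  show ?case using has_shear_const[OF abc(2), of 1] by (simp add: reads_def)
next
  case (insert i I)
  have IH: "has_shear a (\<lambda>u. \<Prod>i\<in>I. F i u)" "reads (\<lambda>u. \<Prod>i\<in>I. F i u) (- {a, b, c})"
    using insert by auto
  have "has_shear a (\<lambda>u. F i u * (\<Prod>i\<in>I. F i u))"
    by (rule has_shear_mult[OF abc _ _ IH(2,1)]) (use insert in auto)
  moreover have "reads (\<lambda>u. F i u * (\<Prod>i\<in>I. F i u)) (- {a, b, c} \<union> - {a, b, c})"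
    by (rule reads_mult[OF _ IH(2)]) (use insert in auto)
  ultimately show ?case using insert.hyps by simp
qed

text \<open>
  Over a finite field every function of finitely many coordinates is a polynomial; only multiples of
  indicator functions of points are needed. The shear of \<open>\<phi>\<close> moves nothing but points that agree with
  \<open>w\<close> off the three coordinates \<open>a\<close>, \<open>b\<close>, \<open>c\<close>.
\<close>

theorem has_shear_point_function:
  assumes abc: "distinct [a, b, c]" "a < N" "b < N" "c < N"
  shows "\<exists>\<phi>. has_shear a \<phi> \<and> \<phi> w = k \<and> (\<forall>u. \<phi> u \<noteq> 0 \<longrightarrow> (\<forall>i<N. i \<notin> {a, b, c} \<longrightarrow> u i = w i))"
proof -
  \<comment> \<open>The product of all \<open>u i - x\<close> with \<open>x\<close> different from \<open>w i\<close> vanishes unless \<open>u\<close> agrees with \<open>w\<close>.\<close>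
  define J where "J = (SIGMA i:{..<N} - {a, b, c}. UNIV - {w i})"
  define F :: "nat \<times> 'k \<Rightarrow> (nat \<Rightarrow> 'k) \<Rightarrow> 'k" where "F = (\<lambda>(i, x) u. u i - x)"
  define \<phi> where "\<phi> u = (\<Prod>j\<in>J. F j u)" for u
  have J: "finite J" by (simp add: J_def)
  have F: "has_shear a (F j) \<and> reads (F j) (- {a, b, c})" if "j \<in> J" for j
  proof -
    obtain i x where ij: "j = (i, x)" by (cases j)
    hence j: "j = (i, x)" "i < N" "i \<notin> {a, b, c}" using that by (simp_all add: J_def)
    have "has_shear a (\<lambda>u. u i + (- x))"
      by (rule has_shear_add[OF reads_coord _ has_shear_coord has_shear_const]) (use j abc in auto)
    moreover have "reads (\<lambda>u. u i - x) (- {a, b, c})" using j by (auto simp: reads_def)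
    ultimately show ?thesis by (simp add: F_def j)
  qed
  have \<phi>_eq: "\<phi> = (\<lambda>u. \<Prod>j\<in>J. F j u)" by (simp add: \<phi>_def fun_eq_iff)
  have "has_shear a (\<lambda>u. \<Prod>j\<in>J. F j u) \<and> reads (\<lambda>u. \<Prod>j\<in>J. F j u) (- {a, b, c})"
    by (rule has_shear_prod[OF abc J]) (use F in blast)+
  hence \<phi>: "has_shear a \<phi>" "reads \<phi> (- {a, b, c})" unfolding \<phi>_eq by blast+
  have \<phi>w: "\<phi> w \<noteq> 0" unfolding \<phi>_def using J by (auto simp: J_def F_def)
  have \<phi>0: "u i = w i" if "\<phi> u \<noteq> 0" "i < N" "i \<notin> {a, b, c}" for u i
  proof (rule ccontr)
    assume "u i \<noteq> w i"
    hence "(i, u i) \<in> J" "F (i, u i) u = 0" using that by (auto simp: J_def F_def)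
    hence "\<phi> u = 0" unfolding \<phi>_def using prod_zero[OF J, of "\<lambda>j. F j u"] by blast
    thus False using that(1) by simp
  qed
  have "has_shear a (\<lambda>u. (k / \<phi> w) * \<phi> u)" by (rule has_shear_scale[OF \<phi>(2) _ \<phi>(1)]) auto
  moreover have "(k / \<phi> w) * \<phi> w = k" using \<phi>w by simp
  moreover have "\<forall>u. (k / \<phi> w) * \<phi> u \<noteq> 0 \<longrightarrow> (\<forall>i<N. i \<notin> {a, b, c} \<longrightarrow> u i = w i)"
    using \<phi>0 by (metis mult_zero_right)
  ultimately show ?thesis by blast
qed

end

section \<open>The alternating group on the points of a vector space\<close>

text \<open>
  The points on which the alternating group will act: the vector space of dimension \<open>N\<close>.
\<close>

definition configs :: "nat \<Rightarrow> (nat \<Rightarrow> 'k::field) set" where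
  "configs N = {u. \<forall>i\<ge>N. u i = 0}"

lemma bij_betw_configs:
  "bij_betw (\<lambda>u. restrict u {..<N}) (configs N :: (nat \<Rightarrow> 'k::field) set) ({..<N} \<rightarrow>\<^sub>E UNIV)"
  by (rule bij_betw_byWitness[where f'="\<lambda>v i. if i < N then v i else 0"])
     (auto simp: configs_def fun_eq_iff PiE_def extensional_def restrict_def)

lemma finite_configs: "finite (configs N :: (nat \<Rightarrow> 'k::{field,finite}) set)"
  using bij_betw_finite[OF bij_betw_configs[where 'k='k, of N]] by (simp add: finite_PiE)

lemma card_configs: "card (configs N :: (nat \<Rightarrow> 'k::{field,finite}) set) = CARD('k) ^ N"
  using bij_betw_same_card[OF bij_betw_configs[where 'k='k, of N]] by (simp add: card_funcsetE)

lemma nat_pow_alt_group: "a [^]\<^bsub>alt_group n\<^esub> (m::nat) = a ^^ m"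
  by (induction m) (simp_all add: alt_group_mult alt_group_one funpow_swap1 fun_eq_iff)

lemma evenperm_of_odd_order:
  assumes "permutation a" "odd p" "a ^^ p = id"
  shows "evenperm a"
proof -
  have "permutation (a ^^ m) \<and> sign (a ^^ m) = sign a ^ m" for m
    by (induction m) (simp_all add: assms(1) permutation_compose sign_compose del: o_apply)
  hence "sign a ^ p = 1" using assms(3) by (metis sign_id)
  thus ?thesis using assms(2) by (cases "evenperm a") (simp_all add: sign_def)
qed

text \<open>
  The action on vectors is carried to \<open>{1..n}\<close> along a bijection. The two conditions on \<open>'k\<close> say that it is the field
  with \<open>p\<close> elements.
\<close>

locale encoding =
  fixes N p n :: nat and \<beta> :: "(nat \<Rightarrow> 'k::{field,finite}) \<Rightarrow> nat"
  assumes N: "N mod 3 = 0" "9 \<le> N"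
    and p: "prime p" "odd p" "of_nat p = (0::'k)"
    and natural: "\<And>x::'k. \<exists>m. x = of_nat m"
    and \<beta>: "bij_betw \<beta> (configs N) {1..n}"
begin

definition transport :: "((nat \<Rightarrow> 'k) \<Rightarrow> nat \<Rightarrow> 'k) \<Rightarrow> nat \<Rightarrow> nat" where
  "transport h x = (if x \<in> {1..n} then \<beta> (h (inv_into (configs N) \<beta> x)) else x)"

lemma transport_\<beta>: "u \<in> configs N \<Longrightarrow> transport h (\<beta> u) = \<beta> (h u)"
  using \<beta> unfolding transport_def by (auto simp: bij_betw_def)

lemma \<beta>_in: "u \<in> configs N \<Longrightarrow> \<beta> u \<in> {1..n}"
  using \<beta> by (auto simp: bij_betw_def)

lemma \<beta>_eq: "u \<in> configs N \<Longrightarrow> v \<in> configs N \<Longrightarrow> \<beta> u = \<beta> v \<longleftrightarrow> u = v"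
  using \<beta> by (auto simp: bij_betw_def inj_on_eq_iff)

lemma \<beta>_cases:
  assumes "x \<in> {1..n}" obtains u where "u \<in> configs N" "x = \<beta> u"
  using assms \<beta> unfolding bij_betw_def by (metis imageE)

lemma transport_outside: "x \<notin> {1..n} \<Longrightarrow> transport h x = x"
  unfolding transport_def by (rule if_not_P)

lemma transport_eqI:
  assumes "\<And>u. u \<in> configs N \<Longrightarrow> f (\<beta> u) = g (\<beta> u)" "\<And>x. x \<notin> {1..n} \<Longrightarrow> f x = g x"
  shows "f = g"
  using assms \<beta>_cases by (metis ext)

lemma transport_comp:
  assumes "\<And>u. u \<in> configs N \<Longrightarrow> h u \<in> configs N"
  shows "transport (g \<circ> h) = transport g \<circ> transport h"
  by (rule transport_eqI) (simp_all add: transport_\<beta> transport_outside assms)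

lemma transport_id: "transport id = id"
  by (rule transport_eqI) (simp_all add: transport_\<beta> transport_outside)

lemma shear_configs:
  assumes "writes f {..<N}" "u \<in> configs N"
  shows "shear f u \<in> configs N"
  using assms by (auto simp: configs_def shear_def writes_def)

lemma transport_shear_power:
  assumes "reads_off_writes f" "writes f {..<N}"
  shows "transport (shear f) ^^ m = transport (shear (\<lambda>u i. of_nat m * f u i))"
proof -
  have "transport (shear f) ^^ m = transport (shear f ^^ m)"
  proof (induction m)
    case (Suc m)
    have "(shear f ^^ m) u \<in> configs N" if "u \<in> configs N" for u
      by (induction m) (simp_all add: that shear_configs[OF assms(2)])
    hence "transport (shear f \<circ> shear f ^^ m) = transport (shear f) \<circ> transport (shear f ^^ m)" by (rule transport_comp)
    thus ?case by (simp only: funpow.simps Suc)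
  qed (simp only: funpow.simps transport_id)
  thus ?thesis by (simp add: shear_power[OF assms(1)])
qed

lemma transport_shear_order: "reads_off_writes f \<Longrightarrow> writes f {..<N} \<Longrightarrow> transport (shear f) ^^ p = id"
  by (simp only: transport_shear_power p(3) shear_zero transport_id)

text \<open>
  The order divides the odd number \<open>p\<close>, and a permutation of odd order is even.
\<close>

lemma transport_shear_in_alt_group:
  assumes "reads_off_writes f" "writes f {..<N}"
  shows "transport (shear f) \<in> carrier (alt_group n)"
proof -
  have o: "transport (shear f) ^^ p = id" by (rule transport_shear_order[OF assms])
  obtain q where q: "p = Suc q" using p(2) by (cases p) auto
  have "bij (transport (shear f))"
  proof (rule o_bij)
    show "(transport (shear f) ^^ q) \<circ> transport (shear f) = id" using o by (simp add: q funpow_Suc_right del: funpow.simps)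
    show "transport (shear f) \<circ> (transport (shear f) ^^ q) = id" using o by (simp add: q)
  qed
  hence perm: "transport (shear f) permutes {1..n}"
    using transport_outside unfolding permutes_def by (metis bij_pointE)
  hence "permutation (transport (shear f))" using permutation_permutes by blast
  thus ?thesis using perm evenperm_of_odd_order[OF _ p(2) o] by (simp add: alt_group_carrier)
qed

definition a :: "nat \<Rightarrow> nat \<Rightarrow> nat" where
  "a i = transport (shear (generator N i))"

definition H :: "(nat \<Rightarrow> nat) set" where
  "H = generate (alt_group n) (a ` {..<6})"

definition M :: "((nat \<Rightarrow> 'k) \<Rightarrow> nat \<Rightarrow> 'k) set" where
  "M = {h. (\<forall>u\<in>configs N. h u \<in> configs N) \<and> transport h \<in> H}"

lemma writes_generator_N: "writes (generator N i :: (nat \<Rightarrow> 'k) \<Rightarrow> nat \<Rightarrow> 'k) {..<N}"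
  by (rule writes_generator) (use N in simp)

lemma a_closed: "i < 6 \<Longrightarrow> a i \<in> carrier (alt_group n)"
  unfolding a_def by (intro transport_shear_in_alt_group reads_off_writes_generator N writes_generator_N)

lemma H_subset: "H \<subseteq> carrier (alt_group n)"
  unfolding H_def using a_closed by (intro group.generate_incl[OF alt_group_is_group]) auto

sublocale H: permutation_group H
proof
  fix g h
  show "bij h" if "h \<in> H"
    using that H_subset by (metis alt_group_carrier permutes_bij subsetD)
  show "g \<circ> h \<in> H" if "g \<in> H" "h \<in> H"
    using generate.eng[of g "alt_group n" "a ` {..<6}" h] that by (simp add: H_def alt_group_mult)
  show "inv' h \<in> H" if "h \<in> H"
  proof -
    have "inv\<^bsub>alt_group n\<^esub> h \<in> H"
      unfolding H_def
      by (rule group.generate_m_inv_closed[OF alt_group_is_group _ that[unfolded H_def]])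
        (use a_closed in auto)
    thus ?thesis using alt_group_inv_equality[of h n] that H_subset by auto
  qed
qed

sublocale shear_moves N M
proof
  show comp: "g \<circ> h \<in> M" if "g \<in> M" "h \<in> M" for g h
    using that H.comp_H transport_comp[of h g] by (auto simp: M_def)
  show "shear (\<lambda>u i. c * f u i) \<in> M" if "reads_off_writes f" "shear f \<in> M" for f c
  proof -
    obtain m where m: "c = of_nat m" using natural by blast
    have "shear f ^^ k \<in> M" for k
    proof (induction k)
      case 0
      have "id \<in> H" using generate.one[of "alt_group n"] by (simp add: H_def alt_group_one)
      hence "transport id \<in> H" by (simp only: transport_id)
      moreover have "\<forall>u\<in>configs N. id u \<in> configs N" by simp
      ultimately show ?case unfolding M_def funpow.simps by blast
    next
      case (Suc k)
      thus ?case using comp[OF that(2) Suc] by (simp only: funpow.simps)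
    qed
    thus ?thesis unfolding m shear_power[OF that(1), symmetric] by blast
  qed
  show "shear (generator N i) \<in> M" if "i < 6" for i
    using that shear_configs[OF writes_generator_N] by (auto simp: M_def H_def a_def intro: generate.incl)
qed (rule N)+

text \<open>
  Choose shears of two distinct coordinates, each supported on the points that agree with \<open>w\<close> off three
  coordinates, with disjoint triples of exempted coordinates. Then \<open>w\<close> is the only point that both move,
  and their commutator is a 3-cycle through \<open>w\<close> and its two images.
\<close>

lemma linked_update:
  assumes w: "w \<in> configs N" and i: "i < N"
  shows "H.linked (\<beta> w) (\<beta> (w(i := x)))"
proof (cases "x = w i")
  case True thus ?thesis by (simp add: H.linked_def)
next
  case False
  have "5 \<le> card ({..<N} - {i})" using N i by simp
  then obtain J where J: "J \<subseteq> {..<N} - {i}" "card J = 5" by (meson obtain_subset_with_card_n)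
  hence "finite J" by (metis card.infinite zero_neq_numeral)
  then obtain js where js: "set js = J" "distinct js" using finite_distinct_list by blast
  hence "length js = 5" using J distinct_card by metis
  then obtain b c a' b' c' where jse: "js = [b, c, a', b', c']"
    by (auto simp: numeral_eq_Suc length_Suc_conv)
  have lt: "b < N" "c < N" "a' < N" "b' < N" "c' < N" using J(1) js(1) jse by auto
  have d: "distinct [i, b, c, a', b', c']" using J(1) js jse by auto
  obtain \<phi> where \<phi>: "has_shear i \<phi>" "\<phi> w = x - w i"
      and \<phi>0: "\<And>u j. \<phi> u \<noteq> 0 \<Longrightarrow> j < N \<Longrightarrow> j \<notin> {i, b, c} \<Longrightarrow> u j = w j"
    using has_shear_point_function[of i b c w "x - w i"] d lt i by auto
  obtain \<psi> where \<psi>: "has_shear a' \<psi>" "\<psi> w = 1"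
      and \<psi>0: "\<And>u j. \<psi> u \<noteq> 0 \<Longrightarrow> j < N \<Longrightarrow> j \<notin> {a', b', c'} \<Longrightarrow> u j = w j"
    using has_shear_point_function[of a' b' c' w 1] d lt i by auto
  define s where "s = transport (shear (single i \<phi>))"
  define t where "t = transport (shear (single a' \<psi>))"
  have has_shearD: "shear (single j \<chi>) u \<in> configs N" "transport (shear (single j \<chi>)) \<in> H"
    if "has_shear j \<chi>" "u \<in> configs N" for j \<chi> u
    using that unfolding has_shear_def unfolding M_def by blast+
  have st: "s \<in> H" "t \<in> H" unfolding s_def t_def using has_shearD(2) \<phi>(1) \<psi>(1) w by blast+
  have fixed: "transport (shear (single j \<chi>)) (\<beta> u) = \<beta> u \<longleftrightarrow> \<chi> u = 0"
    if "has_shear j \<chi>" "u \<in> configs N" for j \<chi> u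
  proof -
    have "shear (single j \<chi>) u \<in> configs N" using that by (rule has_shearD)
    hence "transport (shear (single j \<chi>)) (\<beta> u) = \<beta> u \<longleftrightarrow> shear (single j \<chi>) u = u"
      using that(2) by (simp add: transport_\<beta> \<beta>_eq)
    thus ?thesis by (auto simp: shear_def single_def fun_eq_iff)
  qed
  have supp: "s y \<noteq> y \<and> t y \<noteq> y \<longleftrightarrow> y = \<beta> w" for y
  proof (cases "y \<in> {1..n}")
    case True
    then obtain u where u: "u \<in> configs N" "y = \<beta> u" by (rule \<beta>_cases)
    \<comment> \<open>Each coordinate below \<open>N\<close> lies outside one of the two disjoint triples.\<close>
    have "u = w" if nz: "\<phi> u \<noteq> 0" "\<psi> u \<noteq> 0"
    proof
      fix j
      show "u j = w j"
      proof (cases "j < N")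
        case True
        have "j \<notin> {i, b, c} \<or> j \<notin> {a', b', c'}" using d by auto
        thus ?thesis using \<phi>0[OF nz(1) True] \<psi>0[OF nz(2) True] by blast
      qed (use u w in \<open>auto simp: configs_def\<close>)
    qed
    moreover have "\<phi> w \<noteq> 0" "\<psi> w \<noteq> 0" using \<phi>(2) \<psi>(2) False by auto
    ultimately show ?thesis
      unfolding s_def t_def u(2) using fixed[OF \<phi>(1) u(1)] fixed[OF \<psi>(1) u(1)] \<beta>_eq[OF u(1) w] by auto
  next
    case False
    thus ?thesis using \<beta>_in[OF w] transport_outside by (auto simp: s_def t_def)
  qed
  have "bij s" "bij t" using st H.bij_H by auto
  note cyc = commutator_eq_cycle3[OF this supp]
  let ?c = "cycle_of_list [\<beta> w, s (\<beta> w), t (\<beta> w)]"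
  have ts: "t \<circ> s \<in> H" using st H.comp_H by blast
  hence "(s \<circ> t) \<circ> inv' (t \<circ> s) \<in> H" using st H.comp_H H.inv_H by blast
  moreover have "(s \<circ> t) \<circ> inv' (t \<circ> s) = ?c"
  proof -
    have "(t \<circ> s) \<circ> inv' (t \<circ> s) = id"
      using H.bij_H[OF ts] bij_is_surj surj_iff by blast
    thus ?thesis unfolding cyc(2) by (metis comp_assoc comp_id)
  qed
  ultimately have "?c \<in> H" by simp
  hence "H.linked (\<beta> w) (s (\<beta> w))" using cyc(1) unfolding H.linked_def by blast
  moreover have "shear (single i \<phi>) w = w(i := x)"
    using \<phi>(2) by (simp add: shear_def single_def fun_eq_iff)
  ultimately show ?thesis by (simp add: s_def transport_\<beta>[OF w])
qed

lemma linked_all: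
  assumes "x \<in> {1..n}" "y \<in> {1..n}"
  shows "H.linked x y"
proof -
  obtain u where u: "u \<in> configs N" "x = \<beta> u" using assms(1) by (rule \<beta>_cases)
  obtain v where v: "v \<in> configs N" "y = \<beta> v" using assms(2) by (rule \<beta>_cases)
  \<comment> \<open>Replace the coordinates of \<open>u\<close> by those of \<open>v\<close> one at a time.\<close>
  define m where "m k = (\<lambda>i. if i < k then v i else u i)" for k :: nat
  have m: "m k \<in> configs N" for k using u v by (auto simp: m_def configs_def)
  have "k \<le> N \<Longrightarrow> H.linked (\<beta> u) (\<beta> (m k))" for k
  proof (induction k)
    case 0
    have "m 0 = u" by (simp add: m_def)
    thus ?case by (simp add: H.linked_def)
  next
    case (Suc k)
    have "m (Suc k) = (m k)(k := v k)" by (auto simp: m_def fun_eq_iff)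
    hence "H.linked (\<beta> (m k)) (\<beta> (m (Suc k)))" using linked_update[OF m, of k k "v k"] Suc by simp
    thus ?case using Suc H.linked_trans by simp
  qed
  moreover have "m N = v" using u v by (auto simp: m_def configs_def fun_eq_iff)
  ultimately show ?thesis using u v by force
qed

theorem generate_alt_group: "generate (alt_group n) (a ` {..<6}) = carrier (alt_group n)"
proof
  show "generate (alt_group n) (a ` {..<6}) \<subseteq> carrier (alt_group n)"
    using H_subset by (simp add: H_def)
  have "three_cycles n \<subseteq> H"
  proof
    fix c assume "c \<in> three_cycles n"
    then obtain cs where cs: "c = cycle_of_list cs" "distinct cs" "length cs = 3" "set cs \<subseteq> {1..n}" by auto
    then obtain x y z where xyz: "cs = [x, y, z]" by (auto simp: numeral_eq_Suc length_Suc_conv)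
    have "h i = i" if "h \<in> H" "i \<notin> {1..n}" for h i
      using that H_subset by (metis alt_group_carrier permutes_not_in subsetD)
    hence "cycle_of_list [x, y, z] \<in> H"
      using cs xyz by (intro H.cycle3_mem_if_linked[of x y z "{1..n}"] linked_all) auto
    thus "c \<in> H" using cs xyz by simp
  qed
  hence "generate (alt_group n) (three_cycles n) \<subseteq> H"
    unfolding H_def using a_closed
    by (intro group.generate_subgroup_incl[OF alt_group_is_group] group.generate_is_subgroup[OF alt_group_is_group]) auto
  thus "carrier (alt_group n) \<subseteq> generate (alt_group n) (a ` {..<6})"
    using alt_group_carrier_as_three_cycles[of n] by (simp add: H_def)
qed

lemma finite_carrier: "finite (carrier (alt_group n))"
proof -
  have "carrier (alt_group n) \<subseteq> {q. q permutes {1..n}}" by (auto simp: alt_group_carrier)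
  thus ?thesis using finite_permutations[of "{1..n}"] finite_subset by blast
qed

lemma heisenberg_pair_if_heisenberg_triple:
  assumes "heisenberg_triple (generator N i) (generator N j :: (nat \<Rightarrow> 'k) \<Rightarrow> nat \<Rightarrow> 'k) h" "i < 6" "j < 6"
  shows "heisenberg_pair (alt_group n) p (a i) (a j) (transport (shear h))"
proof -
  note r = heisenberg_triple_relations[OF assms(1)]
  have wh: "writes h {..<N}" by (rule heisenberg_triple_writes[OF assms(1) writes_generator_N])
  note s = shear_configs[OF writes_generator_N] shear_configs[OF wh]
  interpret group "alt_group n" by (rule alt_group_is_group)
  show ?thesis
  proof (unfold_locales)
    show "finite (carrier (alt_group n))" by (rule finite_carrier)
    show "0 < p" "prime p" using p prime_gt_0_nat by auto
    show "a i \<in> carrier (alt_group n)" "a j \<in> carrier (alt_group n)" using assms a_closed by auto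
    show "transport (shear h) \<in> carrier (alt_group n)" by (rule transport_shear_in_alt_group[OF r(3) wh])
    show "a i [^]\<^bsub>alt_group n\<^esub> p = \<one>\<^bsub>alt_group n\<^esub>" "a j [^]\<^bsub>alt_group n\<^esub> p = \<one>\<^bsub>alt_group n\<^esub>"
      unfolding a_def by (simp_all add: nat_pow_alt_group transport_shear_order r writes_generator_N alt_group_one)
    show "a i \<otimes>\<^bsub>alt_group n\<^esub> a j = transport (shear h) \<otimes>\<^bsub>alt_group n\<^esub> (a j \<otimes>\<^bsub>alt_group n\<^esub> a i)"
      using arg_cong[OF r(4), of transport] by (simp add: a_def alt_group_mult transport_comp s)
    show "transport (shear h) \<otimes>\<^bsub>alt_group n\<^esub> a i = a i \<otimes>\<^bsub>alt_group n\<^esub> transport (shear h)"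
      using arg_cong[OF r(5), of transport] by (simp add: a_def alt_group_mult transport_comp s)
    show "transport (shear h) \<otimes>\<^bsub>alt_group n\<^esub> a j = a j \<otimes>\<^bsub>alt_group n\<^esub> transport (shear h)"
      using arg_cong[OF r(6), of transport] by (simp add: a_def alt_group_mult transport_comp s)
  qed
qed

lemma generated_by_exponent:
  assumes "25 < p"
  shows "generated_by_exponent (alt_group n) p {..<6} a (1 / sqrt p)"
proof -
  interpret group "alt_group n" by (rule alt_group_is_group)
  interpret finite_group_of_exponent "alt_group n" p
    by unfold_locales (use finite_carrier p(1) prime_gt_0_nat in simp_all)
  show ?thesis
  proof
    have "sqrt 25 < sqrt p" using assms by (simp only: real_sqrt_less_iff)
    thus "(real (card {..<6::nat}) - 1) * (1 / sqrt p) < 1" by (simp add: divide_less_eq)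
    show "{..<6::nat} \<noteq> {}" by (simp add: lessThan_empty_iff)
    show "finite {..<6::nat}" "0 \<le> 1 / sqrt (real p)" by simp_all
    show "a i \<in> carrier (alt_group n)" if "i \<in> {..<6}" for i using that a_closed by auto
    show "a i [^]\<^bsub>alt_group n\<^esub> p = \<one>\<^bsub>alt_group n\<^esub>" if "i \<in> {..<6}" for i
    proof -
      have "reads_off_writes (generator N i :: (nat \<Rightarrow> 'k) \<Rightarrow> nat \<Rightarrow> 'k)" by (rule reads_off_writes_generator[OF N]) (use that in simp)
      thus ?thesis unfolding a_def by (simp add: nat_pow_alt_group transport_shear_order writes_generator_N alt_group_one)
    qed
    show "generate (alt_group n) (a ` {..<6}) = carrier (alt_group n)" by (rule generate_alt_group)
    fix i j :: nat and v
    assume ij: "i \<in> {..<6}" "j \<in> {..<6}" "i \<noteq> j"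
    have "\<exists>h. heisenberg_triple (generator N i) (generator N j) h \<or> heisenberg_triple (generator N j) (generator N i :: (nat \<Rightarrow> 'k) \<Rightarrow> nat \<Rightarrow> 'k) h"
      using heisenberg_triple_generators[OF N, of i j] heisenberg_triple_generators[OF N, of j i] ij by (cases "i < j") auto
    then obtain h where "heisenberg_triple (generator N i) (generator N j) h \<or> heisenberg_triple (generator N j) (generator N i :: (nat \<Rightarrow> 'k) \<Rightarrow> nat \<Rightarrow> 'k) h"
      by blast
    thus "- (1 / sqrt p) * (ip (\<lambda>g. v g - avg (a i) v g) (\<lambda>g. v g - avg (a i) v g)
            + ip (\<lambda>g. v g - avg (a j) v g) (\<lambda>g. v g - avg (a j) v g))
       \<le> 2 * ip (\<lambda>g. v g - avg (a i) v g) (\<lambda>g. v g - avg (a j) v g)"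
      using heisenberg_pair.almost_orthogonal_complements[OF heisenberg_pair_if_heisenberg_triple, of i j h v]
        heisenberg_pair.almost_orthogonal_complements[OF heisenberg_pair_if_heisenberg_triple, of j i h v] ij
      by (auto simp: ip_commute add.commute)
  qed
qed

end

section \<open>Expanding generating sets\<close>

text \<open>
  Six generators require \<open>5 / sqrt p < 1\<close>, and 29 is the least prime above 25. The index type only serves
  to name the field with 29 elements, \<open>residue29 mod_ring\<close>.
\<close>

typedef residue29 = "{..<29::nat}"
  by (rule exI[of _ 0]) simp

lemma card_residue29: "CARD(residue29) = 29"
  using type_definition.card[OF type_definition_residue29] by simp

instance residue29 :: prime_card
  by standard (simp add: card_residue29)

text \<open>
  The constant \<open>\<kappa>\<close> is that of \<open>powers_expand\<close> for six generators and \<open>e = 1 / sqrt 29\<close>; it is halved in order to make the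
  inequality strict. The generating set consists of the powers of the generators, at most \<open>6 * 29\<close> in
  number.
\<close>

theorem alt_group_expander:
  assumes N: "N mod 3 = 0" "9 \<le> N"
  defines "n \<equiv> 29 ^ N" and "\<kappa> \<equiv> (1 - sqrt (1 - (1 - 5 / sqrt 29) / 6))\<^sup>2 / 24"
  shows "\<exists>F. generating_set (alt_group n) F \<and> card F \<le> 174 \<and>
    is_expander (\<kappa> / 2) (cayley_graph (alt_group n) F)"
proof -
  let ?C = "configs N :: (nat \<Rightarrow> residue29 mod_ring) set"
  have "card ?C = card {1..n}" by (simp add: card_configs card_residue29 n_def)
  then obtain \<beta> where \<beta>: "bij_betw \<beta> ?C {1..n}"
    using finite_same_card_bij[OF finite_configs] by blast
  interpret encoding N 29 n \<beta>
  proof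
    show "of_nat 29 = (0 :: residue29 mod_ring)"
      using of_nat_card_eq_0[where 'a=residue29] by (simp only: card_residue29)
    show "\<exists>m. x = of_nat m" for x :: "residue29 mod_ring" using surj_of_nat_mod_ring[of x] by blast
  qed (use N \<beta> in auto)
  interpret E: generated_by_exponent "alt_group n" 29 "{..<6}" a "1 / sqrt 29"
    using generated_by_exponent by simp
  have ratio: "E.ratio = 1 - (1 - 5 / sqrt 29) / 6"
    by (simp add: E.ratio_def E.gap_def)
  have sq: "5 < sqrt 29" by (rule real_less_rsqrt) simp
  have \<kappa>: "0 < \<kappa>" "\<kappa> < 1"
  proof -
    have r: "0 \<le> sqrt E.ratio" "sqrt E.ratio < 1" using E.ratio_bounds by auto
    have "0 < (1 - sqrt E.ratio)\<^sup>2" "(1 - sqrt E.ratio)\<^sup>2 \<le> 1" using r by (auto simp: power_le_one)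
    thus "0 < \<kappa>" "\<kappa> < 1" unfolding \<kappa>_def ratio by auto
  qed
  show ?thesis
  proof (intro exI conjI)
    show "generating_set (alt_group n) E.powers" by (rule E.generating_powers) simp
    show "card E.powers \<le> 174" using E.card_powers by simp
    show "is_expander (\<kappa> / 2) (cayley_graph (alt_group n) E.powers)"
      unfolding is_expander_def
    proof (intro conjI allI impI)
      show "pair_pseudo_graph (cayley_graph (alt_group n) E.powers)"
        by (rule pair_pseudo_graph_cayley_graph[OF finite_carrier])
      show "0 < \<kappa> / 2" "\<kappa> / 2 < 1" using \<kappa> by auto
      fix A
      assume "A \<subseteq> pverts (cayley_graph (alt_group n) E.powers) \<and> A \<noteq> {} \<and>
        real (card A) \<le> real (card (pverts (cayley_graph (alt_group n) E.powers))) / 2"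
      hence A: "A \<subseteq> carrier (alt_group n)" "A \<noteq> {}" "real (card A) \<le> real (card (carrier (alt_group n))) / 2"
        by (simp_all add: cayley_graph_def)
      have "0 < card A" using A finite_subset[OF A(1) finite_carrier] by (simp add: card_gt_0_iff)
      hence "\<kappa> / 2 * card A < \<kappa> * card A" using \<kappa> by simp
      also have "\<dots> \<le> card (vertex_boundary (cayley_graph (alt_group n) E.powers) A)"
        using E.powers_expand[OF A(1,3)] by (simp add: \<kappa>_def ratio)
      finally show "\<kappa> / 2 * real (card A) < real (card (vertex_boundary (cayley_graph (alt_group n) E.powers) A))" .
    qed
  qed
qed

theorem theorem5:
  shows "\<exists>(L :: real) (\<epsilon> :: real) (n :: nat \<Rightarrow> nat).
           L > 0 \<and> 0 < \<epsilon> \<and> \<epsilon> < 1 \<and> inj n \<and> (\<forall>s. n s > 0) \<and>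
           (\<forall>s. \<exists>F. generating_set (alt_group (n s)) F \<and> real (card F) \<le> L \<and>
                    is_expander \<epsilon> (cayley_graph (alt_group (n s)) F))"
proof -
  define \<epsilon> where "\<epsilon> = (1 - sqrt (1 - (1 - 5 / sqrt 29) / 6))\<^sup>2 / 24 / 2"
  define n where "n s = (29 :: nat) ^ (3 * (s + 3))" for s :: nat
  have F: "\<exists>F. generating_set (alt_group (n s)) F \<and> real (card F) \<le> 174 \<and>
      is_expander \<epsilon> (cayley_graph (alt_group (n s)) F)" for s
    using alt_group_expander[of "3 * (s + 3)"] unfolding n_def \<epsilon>_def by force
  have "0 < \<epsilon>" "\<epsilon> < 1" using F[of 0] by (auto simp: is_expander_def)
  moreover have "inj n" by (auto simp: n_def inj_def)
  moreover have "\<forall>s. n s > 0" by (simp add: n_def)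
  ultimately show ?thesis using F by (intro exI[of _ 174] exI[of _ \<epsilon>] exI[of _ n]) auto
qed

end
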